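(* Let $\mathcal V$ be a variety of finite signature such that $\mathcal V_{f.g.}$ has the ascending chain condition and the isomorphism problem for finite presentations in $\mathcal V$ is decidable. Let $(\alpha_n)_{n\ge1}$ be a sequence of ordinals $\le\omega^\omega$ such that $\cong_{\mathcal V_n}\ \le_c\ E_{\min}(\alpha_n)$ for all $n\ge1$, and let $\lambda=\sup_n\alpha_n$. Then $E_{\min}(\lambda)\ \not\le_c\ \cong_{\mathcal V_{f.g.}}$.
   Context: $W_e$ denotes the $e$-th c.e. set and $\langle\cdot,\cdot\rangle$ a computable pairing function. A variety is the class of algebras in a fixed algebraic signature satisfying a fixed c.e. set of equational laws. For $k\ge1$, $X_k=\{x_0,\dots,x_{k-1}\}$; fix a computable bijective coding of pairs of terms over $X_k$ by natural numbers, and for a set $R$ of pairs let $\langle X_k\mid R\rangle_{\mathcal V}$ be $\mathcal T(X_k)$ modulo the smallest congruence containing $R$ and all instances of the laws of $\mathcal V$. $\mathcal V_n[e]=\langle X_n\mid W_e\rangle_{\mathcal V}$ with $e\cong_{\mathcal V_n}i$ iff $\mathcal V_n[e]\cong\mathcal V_n[i]$; $\mathcal V_{f.g.}$ consists of $\mathcal V_{f.g.}[\langle k,e\rangle]=\langle X_k\mid W_e\rangle_{\mathcal V}$ ($k\ge1$) with $\langle k,e\rangle\cong_{\mathcal V_{f.g.}}\langle j,i\rangle$ iff these are isomorphic. ACC: every ascending chain of congruences of every algebra in $\mathcal V_{f.g.}$ is eventually constant. The isomorphism problem for finite presentations is decidable if there is an algorithm that, given finite $k,j$ and finite sets $R,S$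 of pairs of terms, decides whether $\langle X_k\mid R\rangle_{\mathcal V}\cong\langle X_j\mid S\rangle_{\mathcal V}$. For an ordinal $\alpha\le\omega^\omega$, fix a computable bijection $h$ from the ordinals $<\alpha$ (Cantor normal forms coded as finite tuples) onto $\mathbb N$, let $n\le_\alpha m$ iff $h^{-1}(n)\le h^{-1}(m)$, and $e\,E_{\min}(\alpha)\,i$ iff $W_e,W_i$ are both empty or have the same $\le_\alpha$-least element. $E\le_c F$ means there is a total computable $h$ with $x\,E\,y\iff h(x)\,F\,h(y)$. *)

theory Defs
  imports Main "HOL-Library.Nat_Bijection"
begin

section \<open>Computable functions and c.e. sets\<close>

text \<open>
  Programs for the unary partial recursive functions. Functions of several arguments receive them
  packed by the Cantor pairing function \<^const>\<open>prod_encode\<close>, which is also the pairing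
  used everywhere below.
\<close>

datatype recf =
    RZero | RSucc | RFst | RSnd
  | RPair recf recf
  | RComp recf recf
  | RPrec recf recf
  | RMu recf

text \<open>\<open>eval p x y\<close>: program \<open>p\<close> halts on input \<open>x\<close> with output \<open>y\<close>.\<close>

inductive eval :: "recf \<Rightarrow> nat \<Rightarrow> nat \<Rightarrow> bool" where
  zero: "eval RZero x 0"
| succ: "eval RSucc x (Suc x)"
| fst: "eval RFst (prod_encode (a, b)) a"
| snd: "eval RSnd (prod_encode (a, b)) b"
| pair: "eval p x a \<Longrightarrow> eval q x b \<Longrightarrow> eval (RPair p q) x (prod_encode (a, b))"
| comp: "eval q x y \<Longrightarrow> eval p y z \<Longrightarrow> eval (RComp p q) x z"
| prec_0: "eval p a y \<Longrightarrow> eval (RPrec p q) (prod_encode (a, 0)) y"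
| prec_Suc: "eval (RPrec p q) (prod_encode (a, n)) y \<Longrightarrow>
    eval q (prod_encode (a, prod_encode (n, y))) z \<Longrightarrow>
    eval (RPrec p q) (prod_encode (a, Suc n)) z"
| mu: "eval p (prod_encode (x, n)) 0 \<Longrightarrow>
    (\<forall>m<n. \<exists>k. eval p (prod_encode (x, m)) (Suc k)) \<Longrightarrow> eval (RMu p) x n"

inductive_cases eval_elims:
  "eval RZero x y" "eval RSucc x y" "eval RFst x y" "eval RSnd x y" "eval (RPair p q) x y"
  "eval (RComp p q) x y" "eval (RPrec p q) x y" "eval (RMu p) x y"

lemma eval_deterministic: "eval p x y \<Longrightarrow> eval p x z \<Longrightarrow> y = z"
proof (induction arbitrary: z rule: eval.induct)
  case (pair p x a q b)
  from pair.prems show ?case by (rule eval_elims(5)) (simp add: pair.IH)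
next
  case (comp q x y p z')
  from comp.prems show ?case
  proof (rule eval_elims(6))
    fix y' assume "eval q x y'" and z: "eval p y' z"
    then have "y = y'" using comp.IH(1) by blast
    with z show "z' = z" using comp.IH(2) by blast
  qed
next
  case (prec_0 p a y q)
  from prec_0.prems show ?case by (rule eval_elims(7)) (simp_all add: prec_0.IH)
next
  case (prec_Suc p q a n y z')
  from prec_Suc.prems show ?case
  proof (rule eval_elims(7))
    fix a' n' y'
    assume eq: "prod_encode (a, Suc n) = prod_encode (a', Suc n')"
      and y': "eval (RPrec p q) (prod_encode (a', n')) y'"
      and z: "eval q (prod_encode (a', prod_encode (n', y'))) z"
    from eq have [simp]: "a' = a" "n' = n" by simp_all
    from y' have "y = y'" using prec_Suc.IH(1) by simp
    with z show "z' = z" using prec_Suc.IH(2) by simp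
  qed simp
next
  case (mu p x n)
  from mu.prems show ?case
  proof (rule eval_elims(8))
    assume z: "eval p (prod_encode (x, z)) 0"
      and less: "\<forall>m<z. \<exists>k. eval p (prod_encode (x, m)) (Suc k)"
    have "\<not> n < z" using less mu.IH(1) by fastforce
    moreover have "\<not> z < n" using z mu.IH(2) by fastforce
    ultimately show "n = z" by simp
  qed
qed (auto elim: eval_elims)

definition computable :: "(nat \<Rightarrow> nat) \<Rightarrow> bool" where
  "computable f \<longleftrightarrow> (\<exists>p. \<forall>x. eval p x (f x))"

primrec recf_num :: "recf \<Rightarrow> nat" where
  "recf_num RZero = prod_encode (0, 0)"
| "recf_num RSucc = prod_encode (1, 0)"
| "recf_num RFst = prod_encode (2, 0)"
| "recf_num RSnd = prod_encode (3, 0)"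
| "recf_num (RPair p q) = prod_encode (4, prod_encode (recf_num p, recf_num q))"
| "recf_num (RComp p q) = prod_encode (5, prod_encode (recf_num p, recf_num q))"
| "recf_num (RPrec p q) = prod_encode (6, prod_encode (recf_num p, recf_num q))"
| "recf_num (RMu p) = prod_encode (7, recf_num p)"

lemma recf_num_inject: "recf_num p = recf_num q \<Longrightarrow> p = q"
proof (induction p arbitrary: q)
  case (RPair p1 p2) then show ?case by (cases q) auto
next
  case (RComp p1 p2) then show ?case by (cases q) auto
next
  case (RPrec p1 p2) then show ?case by (cases q) auto
next
  case (RMu p) then show ?case by (cases q) auto
qed (case_tac [!] q, auto)

text \<open>\<open>W e\<close> is the domain of the program with number \<open>e\<close>; it is empty if \<open>e\<close> is not the number
  of a program.\<close>

definition W :: "nat \<Rightarrow> nat set" where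
  "W e = {x. \<exists>p y. recf_num p = e \<and> eval p x y}"

definition reducible :: "(nat \<Rightarrow> nat \<Rightarrow> bool) \<Rightarrow> (nat \<Rightarrow> nat \<Rightarrow> bool) \<Rightarrow> bool"
    (infix "\<le>\<^sub>c" 50) where
  "E \<le>\<^sub>c F \<longleftrightarrow> (\<exists>f. computable f \<and> (\<forall>x y. E x y \<longleftrightarrow> F (f x) (f y)))"


section \<open>Algebras over a finite signature\<close>

text \<open>
  A finite signature is a list of arities: the operation symbols are the numbers
  \<open>f < length sig\<close>, and \<open>f\<close> has arity \<open>sig ! f\<close>. The values of \<open>op\<close> outside the signature, or
  on argument lists of the wrong length or outside the carrier, are irrelevant.
\<close>

type_synonym signature = "nat list"

record 'a algebra =
  carrier :: "'a set"
  op :: "nat \<Rightarrow> 'a list \<Rightarrow> 'a"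

definition congruence :: "signature \<Rightarrow> 'a algebra \<Rightarrow> 'a rel \<Rightarrow> bool" where
  "congruence sig A \<theta> \<longleftrightarrow> equiv (carrier A) \<theta> \<and>
    (\<forall>f<length sig. \<forall>xs ys. length xs = sig ! f \<longrightarrow> list_all2 (\<lambda>x y. (x, y) \<in> \<theta>) xs ys \<longrightarrow>
       (op A f xs, op A f ys) \<in> \<theta>)"

definition generated_congruence :: "signature \<Rightarrow> 'a algebra \<Rightarrow> 'a rel \<Rightarrow> 'a rel" where
  "generated_congruence sig A S = \<Inter>{\<theta>. congruence sig A \<theta> \<and> S \<subseteq> \<theta>}"

definition quotient_algebra :: "'a algebra \<Rightarrow> 'a rel \<Rightarrow> 'a set algebra" where
  "quotient_algebra A \<theta> =
    \<lparr>carrier = carrier A // \<theta>,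
     op = (\<lambda>f Cs. \<theta> `` {op A f xs | xs. list_all2 (\<in>) xs Cs})\<rparr>"

definition isomorphic :: "signature \<Rightarrow> 'a algebra \<Rightarrow> 'b algebra \<Rightarrow> bool" where
  "isomorphic sig A B \<longleftrightarrow> (\<exists>\<phi>. bij_betw \<phi> (carrier A) (carrier B) \<and>
    (\<forall>f<length sig. \<forall>xs. length xs = sig ! f \<longrightarrow> set xs \<subseteq> carrier A \<longrightarrow>
       \<phi> (op A f xs) = op B f (map \<phi> xs)))"

definition ACC :: "signature \<Rightarrow> 'a algebra \<Rightarrow> bool" where
  "ACC sig A \<longleftrightarrow> (\<forall>\<theta> :: nat \<Rightarrow> 'a rel.
    (\<forall>n. congruence sig A (\<theta> n)) \<and> (\<forall>n. \<theta> n \<subseteq> \<theta> (Suc n)) \<longrightarrow> (\<exists>N. \<forall>n\<ge>N. \<theta> n = \<theta> N))"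


section \<open>Terms, varieties and presentations\<close>

datatype trm = Var nat | Fn nat "trm list"

inductive_set terms :: "signature \<Rightarrow> nat set \<Rightarrow> trm set" for sig X where
  "i \<in> X \<Longrightarrow> Var i \<in> terms sig X"
| "f < length sig \<Longrightarrow> length ts = sig ! f \<Longrightarrow> (\<forall>t\<in>set ts. t \<in> terms sig X) \<Longrightarrow>
    Fn f ts \<in> terms sig X"

definition term_algebra :: "signature \<Rightarrow> nat set \<Rightarrow> trm algebra" where
  "term_algebra sig X = \<lparr>carrier = terms sig X, op = Fn\<rparr>"

definition pairs :: "signature \<Rightarrow> nat \<Rightarrow> (trm \<times> trm) set" where
  "pairs sig k = terms sig {..<k} \<times> terms sig {..<k}"

primrec subst :: "(nat \<Rightarrow> trm) \<Rightarrow> trm \<Rightarrow> trm" where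
  "subst \<sigma> (Var i) = \<sigma> i"
| "subst \<sigma> (Fn f ts) = Fn f (map (subst \<sigma>) ts)"

primrec trm_num :: "trm \<Rightarrow> nat" where
  "trm_num (Var i) = prod_encode (0, i)"
| "trm_num (Fn f ts) = prod_encode (Suc f, list_encode (map trm_num ts))"

lemma trm_num_inject: "trm_num s = trm_num t \<Longrightarrow> s = t"
proof (induction s arbitrary: t)
  case (Var i) then show ?case by (cases t) auto
next
  case (Fn f ss)
  then obtain ts where t: "t = Fn f ts" and "map trm_num ss = map trm_num ts"
    by (cases t) (auto simp: list_encode_eq)
  with Fn.IH have "ss = ts"
    by (auto simp: list_eq_iff_nth_eq dest!: map_eq_imp_length_eq)
  with t show ?case by simp
qed

definition pair_num :: "trm \<times> trm \<Rightarrow> nat" where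
  "pair_num p = prod_encode (trm_num (fst p), trm_num (snd p))"

text \<open>A variety is given by its signature and a c.e. set of laws in the variables
  \<open>Var 0, Var 1, \<dots>\<close>.\<close>

definition variety :: "signature \<Rightarrow> (trm \<times> trm) set \<Rightarrow> bool" where
  "variety sig L \<longleftrightarrow> L \<subseteq> terms sig UNIV \<times> terms sig UNIV \<and> (\<exists>e. pair_num ` L = W e)"

definition law_instances :: "signature \<Rightarrow> (trm \<times> trm) set \<Rightarrow> nat set \<Rightarrow> trm rel" where
  "law_instances sig L X =
    {(subst \<sigma> s, subst \<sigma> t) | \<sigma> s t. (s, t) \<in> L \<and> range \<sigma> \<subseteq> terms sig X}"

definition presented :: "signature \<Rightarrow> (trm \<times> trm) set \<Rightarrow> nat \<Rightarrow> trm rel \<Rightarrow> trm set algebra" where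
  "presented sig L k R =
    (let T = term_algebra sig {..<k}
     in quotient_algebra T (generated_congruence sig T (R \<union> law_instances sig L {..<k})))"

text \<open>
  A computable bijective coding \<open>c k\<close> of the pairs of terms over \<open>{Var 0, \<dots>, Var (k - 1)}\<close>,
  computable uniformly in \<open>k \<ge> 1\<close>. If no symbol has positive arity, there are
  only finitely many pairs and surjectivity is impossible; then \<open>c k\<close> is merely injective and
  numbers that code no pair are ignored in \<open>V_alg\<close> below.
\<close>

definition pair_coding :: "signature \<Rightarrow> (nat \<Rightarrow> trm \<times> trm \<Rightarrow> nat) \<Rightarrow> bool" where
  "pair_coding sig c \<longleftrightarrow>
    (\<forall>k\<ge>1. if infinite (pairs sig k) then bij_betw (c k) (pairs sig k) UNIV
            else inj_on (c k) (pairs sig k)) \<and>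
    (\<exists>f. computable f \<and> (\<forall>k\<ge>1. \<forall>p\<in>pairs sig k. f (prod_encode (k, pair_num p)) = c k p))"

text \<open>The \<open>n\<close>-generated algebra with relations \<open>W e\<close>.\<close>

definition V_alg ::
    "signature \<Rightarrow> (trm \<times> trm) set \<Rightarrow> (nat \<Rightarrow> trm \<times> trm \<Rightarrow> nat) \<Rightarrow> nat \<Rightarrow> nat \<Rightarrow> trm set algebra" where
  "V_alg sig L c n e = presented sig L n {p \<in> pairs sig n. c n p \<in> W e}"

definition iso_n ::
    "signature \<Rightarrow> (trm \<times> trm) set \<Rightarrow> (nat \<Rightarrow> trm \<times> trm \<Rightarrow> nat) \<Rightarrow> nat \<Rightarrow> nat \<Rightarrow> nat \<Rightarrow> bool" where
  "iso_n sig L c n e i \<longleftrightarrow> isomorphic sig (V_alg sig L c n e) (V_alg sig L c n i)"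

text \<open>
  An equivalence relation on the codes of pairs \<open>(k, e)\<close> with \<open>k \<ge> 1\<close>; the other numbers are not
  related to anything. As they are not even related to themselves, a reduction of a reflexive
  relation to \<open>iso_fg\<close> takes values in the codes with \<open>k \<ge> 1\<close> only.
\<close>

definition iso_fg ::
    "signature \<Rightarrow> (trm \<times> trm) set \<Rightarrow> (nat \<Rightarrow> trm \<times> trm \<Rightarrow> nat) \<Rightarrow> nat \<Rightarrow> nat \<Rightarrow> bool" where
  "iso_fg sig L c a b \<longleftrightarrow> (\<exists>k e j i. a = prod_encode (k, e) \<and> b = prod_encode (j, i) \<and>
     k \<ge> 1 \<and> j \<ge> 1 \<and> isomorphic sig (V_alg sig L c k e) (V_alg sig L c j i))"

definition ACC_fg ::
    "signature \<Rightarrow> (trm \<times> trm) set \<Rightarrow> (nat \<Rightarrow> trm \<times> trm \<Rightarrow> nat) \<Rightarrow> bool" where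
  "ACC_fg sig L c \<longleftrightarrow> (\<forall>k\<ge>1. \<forall>e. ACC sig (V_alg sig L c k e))"

text \<open>Finite sets of relations are given to the algorithm as lists.\<close>

definition fp_iso_decidable :: "signature \<Rightarrow> (trm \<times> trm) set \<Rightarrow> bool" where
  "fp_iso_decidable sig L \<longleftrightarrow> (\<exists>d. computable d \<and>
    (\<forall>k\<ge>1. \<forall>j\<ge>1. \<forall>rs ss. set rs \<subseteq> pairs sig k \<longrightarrow> set ss \<subseteq> pairs sig j \<longrightarrow>
      d (prod_encode (prod_encode (k, j),
           prod_encode (list_encode (map pair_num rs), list_encode (map pair_num ss)))) =
      (if isomorphic sig (presented sig L k (set rs)) (presented sig L j (set ss)) then 1 else 0)))"


section \<open>Ordinals up to \<open>\<omega>\<^sup>\<omega>\<close>\<close>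

text \<open>
  The ordinal below \<open>\<omega>\<^sup>\<omega>\<close> with Cantor normal form
  \<open>\<omega>\<^sup>m \<cdot> c\<^sub>m + \<dots> + \<omega> \<cdot> c\<^sub>1 + c\<^sub>0\<close>, where \<open>c\<^sub>m \<noteq> 0\<close>,
  is the coefficient list \<open>[c\<^sub>m, \<dots>, c\<^sub>1, c\<^sub>0]\<close>, and \<open>0\<close> is the empty list. These lists are ordered
  first by length and then lexicographically.

  An ordinal \<open>\<alpha> \<le> \<omega>\<^sup>\<omega>\<close> is the set of all smaller ordinals, i.e. an initial segment of
  \<open>cnf\<close>; so \<open>\<alpha> \<le> \<beta>\<close> is \<open>\<alpha> \<subseteq> \<beta>\<close>, suprema are unions, and \<open>\<omega>\<^sup>\<omega>\<close> is \<open>cnf\<close> itself.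
\<close>

definition cnf :: "nat list set" where
  "cnf = {cs. cs \<noteq> [] \<longrightarrow> hd cs \<noteq> 0}"

definition cnf_less :: "nat list rel" where
  "cnf_less = lenlex less_than"

lemma wf_cnf_less: "wf cnf_less" and total_cnf_less: "total cnf_less"
  and trans_cnf_less: "trans cnf_less"
  unfolding cnf_less_def by (auto intro: wf_lenlex total_lenlex lenlex_transI)

definition ordinal :: "nat list set \<Rightarrow> bool" where
  "ordinal \<alpha> \<longleftrightarrow> \<alpha> \<subseteq> cnf \<and> (\<forall>\<beta>\<in>\<alpha>. \<forall>\<gamma>\<in>cnf. (\<gamma>, \<beta>) \<in> cnf_less \<longrightarrow> \<gamma> \<in> \<alpha>)"

definition ordinal_coding :: "nat list set \<Rightarrow> (nat list \<Rightarrow> nat) \<Rightarrow> bool" where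
  "ordinal_coding \<alpha> h \<longleftrightarrow> bij_betw h \<alpha> UNIV \<and>
    (\<exists>f. computable f \<and> (\<forall>\<beta>\<in>\<alpha>. f (list_encode \<beta>) = h \<beta>))"

definition ord_le :: "nat list set \<Rightarrow> (nat list \<Rightarrow> nat) \<Rightarrow> nat \<Rightarrow> nat \<Rightarrow> bool" where
  "ord_le \<alpha> h n m \<longleftrightarrow> (inv_into \<alpha> h n, inv_into \<alpha> h m) \<in> cnf_less\<^sup>="

definition is_least :: "nat list set \<Rightarrow> (nat list \<Rightarrow> nat) \<Rightarrow> nat set \<Rightarrow> nat \<Rightarrow> bool" where
  "is_least \<alpha> h S a \<longleftrightarrow> a \<in> S \<and> (\<forall>b\<in>S. ord_le \<alpha> h a b)"

text \<open>\<open>h \<alpha>\<close> is the coding chosen for the ordinal \<open>\<alpha>\<close>, which must be infinite for such a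
  coding to exist.\<close>

definition E_min :: "(nat list set \<Rightarrow> nat list \<Rightarrow> nat) \<Rightarrow> nat list set \<Rightarrow> nat \<Rightarrow> nat \<Rightarrow> bool" where
  "E_min h \<alpha> e i \<longleftrightarrow> (W e = {} \<and> W i = {}) \<or>
    (\<exists>a. is_least \<alpha> (h \<alpha>) (W e) a \<and> is_least \<alpha> (h \<alpha>) (W i) a)"

end

(*
  Suppose f reduces E_min(lambda) to isomorphism of finitely generated algebras. Applied to an
  index of the empty set, f yields a k-generated algebra A. By the ascending chain condition A has
  a finite presentation, so a program that knows its own index can wait until a finite part of the
  presentation produced by f is seen to define A, and only then start to enumerate. Hence all
  algebras produced by f are quotients of A, and enlarging a finite set passes to a quotient.
  All this happens among the quotients of the free algebra F on n = k + 1 generators, and F is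
  not isomorphic to A by the Hopf property (unless the variety is trivial).
  The same waiting trick for a reduction r of isomorphism in V_n to E_min(alpha_n) shows that r maps
  a proper quotient to a strictly smaller least element. The first descent from F to A makes
  the set belonging to A nonempty, with least element beta < alpha_n. So the singletons of
  the ordinals below lambda give a strictly increasing map from lambda into beta,
  although beta < alpha_n <= lambda.
*)
theory Submission
  imports Defs
begin

section \<open>Computable functions and decidable predicates\<close>

text \<open>The two hypotheses on the variety act together: by the chain condition some finite part
  of an enumerated presentation already gives the right algebra, and the decision procedure
  recognises it. The extra generator makes room above A: nothing prevents A from being free on k
  generators, and then no descent among k-generated algebras would end at A, so that the set which r
  assigns to A could be empty. Order is reversed twice. Passing from a larger to a smaller ordinal
  means enlarging a set, hence taking a quotient, and a proper quotient has a smaller least element;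
  so the map from lambda to beta is increasing. The congruences chosen for different singletons need
  not be comparable, only isomorphic to comparable ones; therefore the descent statement speaks of
  indices up to isomorphism. Since beta < lambda, the map can be applied to beta and gives a value
  below beta, which no strictly increasing map of a well-order into itself allows.\<close>

abbreviation cfst :: "nat \<Rightarrow> nat" ("\<pi>\<^sub>1") where "cfst x \<equiv> fst (prod_decode x)"
abbreviation csnd :: "nat \<Rightarrow> nat" ("\<pi>\<^sub>2") where "csnd x \<equiv> snd (prod_decode x)"
abbreviation cpair :: "nat \<Rightarrow> nat \<Rightarrow> nat" ("\<langle>_,/ _\<rangle>") where "\<langle>a, b\<rangle> \<equiv> prod_encode (a, b)"

lemma cpair_surj [simp]: "\<langle>\<pi>\<^sub>1 x, \<pi>\<^sub>2 x\<rangle> = x"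
  by simp

lemma cfst_le: "\<pi>\<^sub>1 x \<le> x" and csnd_le: "\<pi>\<^sub>2 x \<le> x"
  using le_prod_encode_1[of "\<pi>\<^sub>1 x" "\<pi>\<^sub>2 x"] le_prod_encode_2[of "\<pi>\<^sub>2 x" "\<pi>\<^sub>1 x"] by simp_all

named_theorems comp_intros

text \<open>There is no primitive identity program; pairing the two projections gives one because
  the Cantor pairing is surjective.\<close>

lemma computable_id [comp_intros]: "computable (\<lambda>x. x)"
proof -
  have "eval (RPair RFst RSnd) x x" for x
    using eval.pair[OF eval.fst eval.snd, of "\<pi>\<^sub>1 x" "\<pi>\<^sub>2 x"] by simp
  then show ?thesis unfolding computable_def by blast
qed

lemma computable_comp: "computable f \<Longrightarrow> computable g \<Longrightarrow> computable (\<lambda>x. f (g x))"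
  unfolding computable_def by (meson eval.comp)

lemma computable_pair [comp_intros]:
  "computable f \<Longrightarrow> computable g \<Longrightarrow> computable (\<lambda>x. \<langle>f x, g x\<rangle>)"
  unfolding computable_def by (meson eval.pair)

lemma computable_Suc [comp_intros]: "computable f \<Longrightarrow> computable (\<lambda>x. Suc (f x))"
  by (rule computable_comp[of Suc]) (auto simp: computable_def intro: eval.succ)

lemma computable_cfst [comp_intros]: "computable f \<Longrightarrow> computable (\<lambda>x. \<pi>\<^sub>1 (f x))"
proof (rule computable_comp[of \<pi>\<^sub>1])
  have "eval RFst x (\<pi>\<^sub>1 x)" for x
    using eval.fst[of "\<pi>\<^sub>1 x" "\<pi>\<^sub>2 x"] by simp
  then show "computable \<pi>\<^sub>1" unfolding computable_def by blast
qed

lemma computable_csnd [comp_intros]: "computable f \<Longrightarrow> computable (\<lambda>x. \<pi>\<^sub>2 (f x))"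
proof (rule computable_comp[of \<pi>\<^sub>2])
  have "eval RSnd x (\<pi>\<^sub>2 x)" for x
    using eval.snd[of "\<pi>\<^sub>1 x" "\<pi>\<^sub>2 x"] by simp
  then show "computable \<pi>\<^sub>2" unfolding computable_def by blast
qed

lemma computable_const [comp_intros]: "computable (\<lambda>x. n)"
proof (induction n)
  case 0
  show ?case unfolding computable_def using eval.zero by blast
next
  case (Suc n)
  then show ?case by (rule computable_Suc)
qed

text \<open>\<open>RPrec\<close> passes its parameter to every step, so the step may depend on the
  input \<open>x\<close>. The step is packed as a function of one number to match the single
  argument of a program.\<close>

lemma computable_rec_nat [comp_intros]:
  assumes "computable b" "computable (\<lambda>z. s (\<pi>\<^sub>1 z) (\<pi>\<^sub>1 (\<pi>\<^sub>2 z)) (\<pi>\<^sub>2 (\<pi>\<^sub>2 z)))" "computable n"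
  shows "computable (\<lambda>x. rec_nat (b x) (\<lambda>i y. s x i y) (n x))"
proof -
  from assms(1,2) obtain p q where p: "\<And>x. eval p x (b x)"
    and q: "\<And>z. eval q z (s (\<pi>\<^sub>1 z) (\<pi>\<^sub>1 (\<pi>\<^sub>2 z)) (\<pi>\<^sub>2 (\<pi>\<^sub>2 z)))"
    unfolding computable_def by blast
  have "eval (RPrec p q) \<langle>a, m\<rangle> (rec_nat (b a) (\<lambda>i y. s a i y) m)" for a m
  proof (induction m)
    case 0
    show ?case using eval.prec_0[OF p] by simp
  next
    case (Suc m)
    from eval.prec_Suc[OF Suc q] show ?case by simp
  qed
  from this[of "\<pi>\<^sub>1 z" "\<pi>\<^sub>2 z" for z]
  have "computable (\<lambda>z. rec_nat (b (\<pi>\<^sub>1 z)) (\<lambda>i y. s (\<pi>\<^sub>1 z) i y) (\<pi>\<^sub>2 z))"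
    unfolding computable_def by auto
  from computable_comp[OF this computable_pair[OF computable_id assms(3)]] show ?thesis by simp
qed

definition decidable :: "(nat \<Rightarrow> bool) \<Rightarrow> bool" where
  "decidable P \<longleftrightarrow> computable (\<lambda>x. of_bool (P x))"

lemma decidable_comp: "decidable P \<Longrightarrow> computable g \<Longrightarrow> decidable (\<lambda>x. P (g x))"
  unfolding decidable_def by (rule computable_comp)

lemma computable_if [comp_intros]:
  assumes "decidable P" "computable f" "computable g"
  shows "computable (\<lambda>x. if P x then f x else g x)"
proof -
  \<comment> \<open>The recursion runs once or not at all, so it returns the value of the step or
    the start value.\<close>
  have "computable (\<lambda>x. rec_nat (g x) (\<lambda>_ _. f x) (of_bool (P x)))"
    using assms(1) unfolding decidable_def
    by (intro comp_intros computable_comp[OF assms(2)] assms(3))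
  also have "(\<lambda>x. rec_nat (g x) (\<lambda>_ _. f x) (of_bool (P x))) = (\<lambda>x. if P x then f x else g x)"
    by auto
  finally show ?thesis .
qed

lemma decidable_eq_0: 
  assumes "computable f"
  shows "decidable (\<lambda>x. f x = 0)"
proof -
  have "computable (\<lambda>x. rec_nat 1 (\<lambda>_ _. 0) (f x))"
    by (intro comp_intros assms)
  also have "(\<lambda>x. rec_nat 1 (\<lambda>_ _. 0) (f x)) = (\<lambda>x. of_bool (f x = 0))"
    by (rule ext, case_tac "f x") simp_all
  finally show ?thesis unfolding decidable_def .
qed

lemma decidable_const [comp_intros]: "decidable (\<lambda>x. b)"
  unfolding decidable_def by (rule computable_const)

text \<open>All connectives reduce to conditionals with a constant branch.\<close>

lemma decidable_if:
  assumes "decidable P" "decidable Q" "decidable R"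
  shows "decidable (\<lambda>x. if P x then Q x else R x)"
proof -
  have "(\<lambda>x. of_bool (if P x then Q x else R x)) =
      (\<lambda>x. if P x then of_bool (Q x) else of_bool (R x) :: nat)" by auto
  then show ?thesis using assms computable_if unfolding decidable_def by simp
qed

lemma decidable_not [comp_intros]: "decidable P \<Longrightarrow> decidable (\<lambda>x. \<not> P x)"
  using decidable_if[OF _ decidable_const decidable_const, of P False True] by (simp add: if_bool_eq_conj)

lemma decidable_conj [comp_intros]: "decidable P \<Longrightarrow> decidable Q \<Longrightarrow> decidable (\<lambda>x. P x \<and> Q x)"
  using decidable_if[OF _ _ decidable_const, of P Q False] by (simp only: if_bool_eq_disj simp_thms)

lemma decidable_disj [comp_intros]: "decidable P \<Longrightarrow> decidable Q \<Longrightarrow> decidable (\<lambda>x. P x \<or> Q x)"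
  using decidable_not[OF decidable_conj[OF decidable_not decidable_not]] by simp

lemma decidable_imp [comp_intros]: "decidable P \<Longrightarrow> decidable Q \<Longrightarrow> decidable (\<lambda>x. P x \<longrightarrow> Q x)"
  using decidable_disj[OF decidable_not] by (simp only: imp_conv_disj)

lemma computable_pred [comp_intros]: 
  assumes "computable f"
  shows "computable (\<lambda>x. f x - 1)"
proof -
  have "computable (\<lambda>x. rec_nat 0 (\<lambda>i _. i) (f x))" by (intro comp_intros assms)
  also have "(\<lambda>x. rec_nat 0 (\<lambda>i _. i) (f x)) = (\<lambda>x. f x - 1)"
    by (rule ext, case_tac "f x") simp_all
  finally show ?thesis .
qed

lemma computable_diff [comp_intros]:
  assumes "computable f" "computable g"
  shows "computable (\<lambda>x. f x - g x)"
proof -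
  have "computable (\<lambda>x. rec_nat (f x) (\<lambda>_ y. y - 1) (g x))" by (intro comp_intros assms)
  moreover have "rec_nat a (\<lambda>_ y. y - 1) b = a - b" for a b :: nat
    by (induction b) simp_all
  ultimately show ?thesis by simp
qed

lemma decidable_le [comp_intros]:
  "computable f \<Longrightarrow> computable g \<Longrightarrow> decidable (\<lambda>x. f x \<le> g x)"
  using decidable_eq_0[OF computable_diff, of f g] by simp

lemma decidable_less [comp_intros]:
  "computable f \<Longrightarrow> computable g \<Longrightarrow> decidable (\<lambda>x. f x < g x)"
  using decidable_not[OF decidable_le, of g f] by (simp add: not_le)

lemma decidable_eq [comp_intros]:
  "computable f \<Longrightarrow> computable g \<Longrightarrow> decidable (\<lambda>x. f x = g x)"
  using decidable_conj[OF decidable_le decidable_le, of f g g f] by (simp add: eq_iff)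

lemma decidable_ball_less [comp_intros]:
  assumes "decidable (\<lambda>z. P (\<pi>\<^sub>1 z) (\<pi>\<^sub>2 z))" "computable g"
  shows "decidable (\<lambda>x. \<forall>m<g x. P x m)"
proof -
  \<comment> \<open>The recursion step receives
    \<open>\<langle>x, \<langle>i, y\<rangle>\<rangle>\<close>, whereas \<open>P\<close> is given on
    pairs, so the arguments are repacked.\<close>
  have "decidable (\<lambda>z. P (\<pi>\<^sub>1 z) (\<pi>\<^sub>1 (\<pi>\<^sub>2 z)))"
    using decidable_comp[OF assms(1), of "\<lambda>z. \<langle>\<pi>\<^sub>1 z, \<pi>\<^sub>1 (\<pi>\<^sub>2 z)\<rangle>"] by (simp add: comp_intros)
  then have "computable (\<lambda>x. rec_nat 1 (\<lambda>i y. if y = 1 \<and> P x i then 1 else 0) (g x))"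
    by (intro comp_intros assms)
  moreover have "rec_nat 1 (\<lambda>i y. if y = 1 \<and> P x i then 1 else 0) n = (of_bool (\<forall>m<n. P x m) :: nat)"
    for x n by (induction n) (auto simp: less_Suc_eq)
  ultimately show ?thesis unfolding decidable_def by simp
qed

lemma decidable_bex_less [comp_intros]:
  assumes "decidable (\<lambda>z. P (\<pi>\<^sub>1 z) (\<pi>\<^sub>2 z))" "computable g"
  shows "decidable (\<lambda>x. \<exists>m<g x. P x m)"
  using decidable_not[OF decidable_ball_less[of "\<lambda>x m. \<not> P x m", OF decidable_not, OF assms]] by simp

lemma decidable_finite [comp_intros]:
  assumes "finite A" "computable f"
  shows "decidable (\<lambda>x. f x \<in> A)"
  using assms(1)
proof induction
  case (insert a A)
  have "decidable (\<lambda>x. f x = a \<or> f x \<in> A)" by (intro comp_intros assms(2) insert.IH)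
  then show ?case by simp
qed (simp add: decidable_const)

section \<open>Lists coded by numbers\<close>

text \<open>A nonempty list has code \<open>Suc (prod_encode (head, tail))\<close>, so
  \<open>\<pi>\<^sub>2 (y - 1)\<close> is the code of the tail. Truncated subtraction keeps 0, the
  code of the empty list, fixed; thus suffixes may be taken beyond the end.\<close>

definition clsuf :: "nat \<Rightarrow> nat \<Rightarrow> nat" where
  "clsuf l i = rec_nat l (\<lambda>_ y. \<pi>\<^sub>2 (y - 1)) i"

lemma computable_clsuf [comp_intros]:
  "computable f \<Longrightarrow> computable g \<Longrightarrow> computable (\<lambda>x. clsuf (f x) (g x))"
  unfolding clsuf_def by (intro comp_intros)

lemma list_decode_csnd: "list_decode (\<pi>\<^sub>2 (l - 1)) = tl (list_decode l)"
proof (cases l)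
  case 0
  have "\<pi>\<^sub>2 0 = 0" using csnd_le[of 0] by simp
  then show ?thesis using 0 by simp
qed (simp split: prod.split)

lemma list_decode_clsuf: "list_decode (clsuf l i) = drop i (list_decode l)"
  by (induction i) (simp_all add: clsuf_def list_decode_csnd[simplified] drop_Suc tl_drop)

lemma list_decode_eq_Nil [simp]: "list_decode l = [] \<longleftrightarrow> l = 0"
  by (metis list_decode.simps(1) list_decode_eq)

lemma hd_list_decode: "l \<noteq> 0 \<Longrightarrow> hd (list_decode l) = \<pi>\<^sub>1 (l - 1)"
  by (cases l) (simp_all split: prod.split)

lemma length_list_decode_le: "length (list_decode l) \<le> l"
proof (induction l rule: list_decode.induct)
  case (2 n)
  have "\<pi>\<^sub>2 n \<le> n" by (rule csnd_le)
  with 2[of "\<pi>\<^sub>1 n" "\<pi>\<^sub>2 n"] show ?case by (simp add: split_beta)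
qed simp

text \<open>This bound turns quantification over the entries of a coded list into bounded
  quantification, which preserves decidability.\<close>

lemma less_list_code: "x \<in> set (list_decode l) \<Longrightarrow> x < l"
proof (induction l rule: list_decode.induct)
  case (2 n)
  then have "x = \<pi>\<^sub>1 n \<or> x < \<pi>\<^sub>2 n"
    using "2.IH"[of "\<pi>\<^sub>1 n" "\<pi>\<^sub>2 n"] by (auto simp: split_beta)
  then show ?case using cfst_le[of n] csnd_le[of n] by auto
qed simp

lemma nth_clsuf: "i < length (list_decode l) \<longleftrightarrow> clsuf l i \<noteq> 0"
  "clsuf l i \<noteq> 0 \<Longrightarrow> list_decode l ! i = \<pi>\<^sub>1 (clsuf l i - 1)"
proof -
  show *: "i < length (list_decode l) \<longleftrightarrow> clsuf l i \<noteq> 0" for i l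
    unfolding list_decode_eq_Nil[symmetric] list_decode_clsuf by (simp add: not_le)
  show "clsuf l i \<noteq> 0 \<Longrightarrow> list_decode l ! i = \<pi>\<^sub>1 (clsuf l i - 1)"
    using hd_list_decode[of "clsuf l i"] * by (simp add: list_decode_clsuf hd_drop_conv_nth)
qed

lemma decidable_mem_list [comp_intros]:
  assumes "computable f" "computable g"
  shows "decidable (\<lambda>x. f x \<in> set (list_decode (g x)))"
proof -
  have "f x \<in> set (list_decode (g x)) \<longleftrightarrow>
      (\<exists>i<g x. clsuf (g x) i \<noteq> 0 \<and> \<pi>\<^sub>1 (clsuf (g x) i - 1) = f x)" for x
  proof -
    have *: "i < length (list_decode (g x)) \<longleftrightarrow> i < g x \<and> clsuf (g x) i \<noteq> 0" for i
      using length_list_decode_le[of "g x"] nth_clsuf(1)[of i "g x"] by linarith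
    then show ?thesis
      unfolding in_set_conv_nth by (metis nth_clsuf(2))
  qed
  moreover have "decidable (\<lambda>x. \<exists>i<g x. clsuf (g x) i \<noteq> 0 \<and> \<pi>\<^sub>1 (clsuf (g x) i - 1) = f x)"
    by (intro comp_intros computable_comp[OF assms(1)] computable_comp[OF assms(2)] assms(2))
  ultimately show ?thesis by simp
qed

lemma computable_length_list [comp_intros]:
  assumes "computable f"
  shows "computable (\<lambda>x. length (list_decode (f x)))"
proof -
  \<comment> \<open>Counts the nonempty suffixes; \<open>l\<close> rounds suffice because a list is
    no longer than its code.\<close>
  let ?r = "\<lambda>l. rec_nat 0 (\<lambda>i y. if clsuf l i = 0 then y else Suc y)"
  have "?r l n = min n (length (list_decode l))" for l n
  proof (induction n)
    case (Suc n)
    have "clsuf l n = 0 \<longleftrightarrow> length (list_decode l) \<le> n"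
      using nth_clsuf(1)[of n l] by linarith
    then show ?case using Suc by simp
  qed simp
  then have "?r l l = length (list_decode l)" for l
    using length_list_decode_le[of l] by (simp add: min_absorb2)
  moreover have "computable (\<lambda>x. ?r (f x) (f x))"
    by (intro comp_intros computable_comp[OF assms] assms)
  ultimately show ?thesis by simp
qed

lemma decidable_bex_list [comp_intros]:
  assumes "decidable (\<lambda>z. P (\<pi>\<^sub>1 z) (\<pi>\<^sub>2 z))" "computable g"
  shows "decidable (\<lambda>x. \<exists>y\<in>set (list_decode (g x)). P x y)"
proof -
  have "(\<exists>y\<in>set (list_decode l). P x y) \<longleftrightarrow> (\<exists>y<l. y \<in> set (list_decode l) \<and> P x y)" for l x
    using less_list_code by blast
  moreover have "decidable (\<lambda>x. \<exists>y<g x. y \<in> set (list_decode (g x)) \<and> P x y)"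
    by (intro comp_intros assms computable_comp[OF assms(2)])
  ultimately show ?thesis by simp
qed

section \<open>Semidecidable predicates\<close>

text \<open>With projections of decidable relations, the closure properties are a matter of
  combining witnesses; a program is extracted only once, in
  \<open>semidecidable_eval\<close>.\<close>

definition semidecidable :: "(nat \<Rightarrow> bool) \<Rightarrow> bool" where
  "semidecidable P \<longleftrightarrow> (\<exists>Q. decidable Q \<and> (\<forall>x. P x \<longleftrightarrow> (\<exists>n. Q \<langle>x, n\<rangle>)))"

lemma semidecidableI:
  "decidable (\<lambda>z. Q (\<pi>\<^sub>1 z) (\<pi>\<^sub>2 z)) \<Longrightarrow> (\<And>x. P x \<longleftrightarrow> (\<exists>n. Q x n)) \<Longrightarrow> semidecidable P"
  unfolding semidecidable_def by (rule exI[of _ "\<lambda>z. Q (\<pi>\<^sub>1 z) (\<pi>\<^sub>2 z)"]) simp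

lemma semidecidableE:
  assumes "semidecidable P"
  obtains Q where "\<And>f g. computable f \<Longrightarrow> computable g \<Longrightarrow> decidable (\<lambda>x. Q (f x) (g x))"
    "\<And>x. P x \<longleftrightarrow> (\<exists>n. Q x n)"
proof -
  from assms obtain Q where "decidable Q" "\<forall>x. P x \<longleftrightarrow> (\<exists>n. Q \<langle>x, n\<rangle>)"
    unfolding semidecidable_def by blast
  then show ?thesis
    using that[of "\<lambda>x n. Q \<langle>x, n\<rangle>"] decidable_comp[of Q, OF _ computable_pair] by simp
qed

lemma semidecidable_decidable: "decidable P \<Longrightarrow> semidecidable P"
  by (rule semidecidableI[of "\<lambda>x _. P x"]) (simp_all add: decidable_comp[of P] computable_cfst computable_id)

lemma semidecidable_comp: 
  assumes "semidecidable P" "computable g" 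
  shows "semidecidable (\<lambda>x. P (g x))"
proof -
  from assms(1) obtain Q where *: "\<And>f g. computable f \<Longrightarrow> computable g \<Longrightarrow> decidable (\<lambda>x. Q (f x) (g x))"
    "\<And>x. P x \<longleftrightarrow> (\<exists>n. Q x n)" by (rule semidecidableE) blast
  show ?thesis
    by (rule semidecidableI[of "\<lambda>x n. Q (g x) n"]) (intro *(1) comp_intros computable_comp[OF assms(2)], simp add: *(2))
qed

lemma semidecidable_conj:
  assumes "semidecidable P" "semidecidable P'"
  shows "semidecidable (\<lambda>x. P x \<and> P' x)"
proof -
  from assms(1) obtain Q where *: "\<And>f g. computable f \<Longrightarrow> computable g \<Longrightarrow> decidable (\<lambda>x. Q (f x) (g x))"
    "\<And>x. P x \<longleftrightarrow> (\<exists>n. Q x n)" by (rule semidecidableE) blast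
  from assms(2) obtain Q' where **: "\<And>f g. computable f \<Longrightarrow> computable g \<Longrightarrow> decidable (\<lambda>x. Q' (f x) (g x))"
    "\<And>x. P' x \<longleftrightarrow> (\<exists>n. Q' x n)" by (rule semidecidableE) blast
  show ?thesis
  proof (rule semidecidableI[of "\<lambda>x n. Q x (\<pi>\<^sub>1 n) \<and> Q' x (\<pi>\<^sub>2 n)"])
    show "P x \<and> P' x \<longleftrightarrow> (\<exists>n. Q x (\<pi>\<^sub>1 n) \<and> Q' x (\<pi>\<^sub>2 n))" for x
      unfolding *(2) **(2) by (metis fst_conv snd_conv prod_encode_inverse)
  qed (intro comp_intros *(1) **(1))
qed

lemma semidecidable_disj:
  assumes "semidecidable P" "semidecidable P'"
  shows "semidecidable (\<lambda>x. P x \<or> P' x)"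
proof -
  from assms(1) obtain Q where *: "\<And>f g. computable f \<Longrightarrow> computable g \<Longrightarrow> decidable (\<lambda>x. Q (f x) (g x))"
    "\<And>x. P x \<longleftrightarrow> (\<exists>n. Q x n)" by (rule semidecidableE) blast
  from assms(2) obtain Q' where **: "\<And>f g. computable f \<Longrightarrow> computable g \<Longrightarrow> decidable (\<lambda>x. Q' (f x) (g x))"
    "\<And>x. P' x \<longleftrightarrow> (\<exists>n. Q' x n)" by (rule semidecidableE) blast
  show ?thesis
  proof (rule semidecidableI[of "\<lambda>x n. Q x n \<or> Q' x n"])
    show "P x \<or> P' x \<longleftrightarrow> (\<exists>n. Q x n \<or> Q' x n)" for x
      unfolding *(2) **(2) by blast
  qed (intro comp_intros *(1) **(1))
qed

lemma semidecidable_imp: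
  "decidable P \<Longrightarrow> semidecidable Q \<Longrightarrow> semidecidable (\<lambda>x. P x \<longrightarrow> Q x)"
  unfolding imp_conv_disj
  by (intro semidecidable_disj semidecidable_decidable[OF decidable_not])

lemma semidecidable_ex:
  assumes "semidecidable (\<lambda>z. P (\<pi>\<^sub>1 z) (\<pi>\<^sub>2 z))"
  shows "semidecidable (\<lambda>x. \<exists>y. P x y)"
proof -
  from assms obtain Q where *: "\<And>f g. computable f \<Longrightarrow> computable g \<Longrightarrow> decidable (\<lambda>x. Q (f x) (g x))"
    "\<And>x. P (\<pi>\<^sub>1 x) (\<pi>\<^sub>2 x) \<longleftrightarrow> (\<exists>n. Q x n)" by (rule semidecidableE) blast
  show ?thesis
  proof (rule semidecidableI[of "\<lambda>x n. Q \<langle>x, \<pi>\<^sub>1 n\<rangle> (\<pi>\<^sub>2 n)"])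
    show "(\<exists>y. P x y) \<longleftrightarrow> (\<exists>n. Q \<langle>x, \<pi>\<^sub>1 n\<rangle> (\<pi>\<^sub>2 n))" for x
      using *(2)[of "\<langle>x, y\<rangle>" for y] by simp (metis fst_conv snd_conv prod_encode_inverse)
  qed (intro comp_intros *(1))
qed

text \<open>Finitely many witnesses have a common bound, and this bound \<open>b\<close> is the
  single unbounded witness.\<close>

lemma semidecidable_ball_less:
  assumes "semidecidable (\<lambda>z. P (\<pi>\<^sub>1 z) (\<pi>\<^sub>2 z))" "computable g"
  shows "semidecidable (\<lambda>x. \<forall>m<g x. P x m)"
proof -
  from assms(1) obtain Q where *: "\<And>f g. computable f \<Longrightarrow> computable g \<Longrightarrow> decidable (\<lambda>x. Q (f x) (g x))"
    "\<And>x. P (\<pi>\<^sub>1 x) (\<pi>\<^sub>2 x) \<longleftrightarrow> (\<exists>n. Q x n)" by (rule semidecidableE) blast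
  show ?thesis
  proof (rule semidecidableI[of "\<lambda>x b. \<forall>m<g x. \<exists>n<b. Q \<langle>x, m\<rangle> n"])
    show "(\<forall>m<g x. P x m) \<longleftrightarrow> (\<exists>b. \<forall>m<g x. \<exists>n<b. Q \<langle>x, m\<rangle> n)" (is "?l \<longleftrightarrow> ?r") for x
    proof
      assume ?l
      then have "\<forall>m<g x. \<exists>n. Q \<langle>x, m\<rangle> n" using *(2)[of "\<langle>x, m\<rangle>" for m] by simp
      then obtain n where n: "\<And>m. m < g x \<Longrightarrow> Q \<langle>x, m\<rangle> (n m)" by metis
      have "n m < Suc (Max (n ` {..<g x}))" if "m < g x" for m
        using that by (intro le_imp_less_Suc Max_ge) auto
      then show ?r using n by blast
    next
      assume ?r
      then show ?l using *(2)[of "\<langle>x, m\<rangle>" for m] by simp blast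
    qed
  qed (intro comp_intros *(1) computable_comp[OF assms(2)])
qed

text \<open>Unbounded search for the least witness. \<open>RMu\<close> looks for a zero and needs
  positive values before it, so the negation of \<open>Q\<close> is computed.\<close>

lemma semidecidable_eval:
  assumes "semidecidable P"
  shows "\<exists>p. \<forall>x. P x \<longleftrightarrow> (\<exists>y. eval p x y)"
proof -
  from assms obtain Q where *: "\<And>f g. computable f \<Longrightarrow> computable g \<Longrightarrow> decidable (\<lambda>x. Q (f x) (g x))"
    "\<And>x. P x \<longleftrightarrow> (\<exists>n. Q x n)" by (rule semidecidableE) blast
  have "computable (\<lambda>z. of_bool (\<not> Q (\<pi>\<^sub>1 z) (\<pi>\<^sub>2 z)))"
    unfolding decidable_def[symmetric] by (intro comp_intros *(1))
  then obtain p where p: "\<And>z. eval p z (of_bool (\<not> Q (\<pi>\<^sub>1 z) (\<pi>\<^sub>2 z)))"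
    unfolding computable_def by blast
  have "P x \<longleftrightarrow> (\<exists>y. eval (RMu p) x y)" for x
  proof
    assume "P x"
    define n where "n = (LEAST n. Q x n)"
    have n: "Q x n" "\<not> Q x m" if "m < n" for m
      using \<open>P x\<close> *(2) that by (auto simp: n_def intro: LeastI_ex dest: not_less_Least)
    have "Q x n" using \<open>P x\<close> *(2) by (auto simp: n_def intro: LeastI_ex)
    have "eval (RMu p) x n"
    proof (rule eval.mu)
      show "eval p \<langle>x, n\<rangle> 0" using p[of "\<langle>x, n\<rangle>"] \<open>Q x n\<close> by simp
      show "\<forall>m<n. \<exists>k. eval p \<langle>x, m\<rangle> (Suc k)"
        using p[of "\<langle>x, m\<rangle>" for m] n(2) by simp (metis One_nat_def of_bool_eq(2))
    qed
    then show "\<exists>y. eval (RMu p) x y" ..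
  next
    assume "\<exists>y. eval (RMu p) x y"
    then obtain n where "eval p \<langle>x, n\<rangle> 0" by (auto elim: eval_elims(8))
    then have "Q x n" using eval_deterministic[OF _ p[of "\<langle>x, n\<rangle>"]] by fastforce
    then show "P x" using *(2) by blast
  qed
  then show ?thesis by blast
qed

section \<open>Self-referential indices\<close>

text \<open>The number of a program with constant value \<open>n\<close>, computable in
  \<open>n\<close>: the instance of the s-m-n theorem that self-reference requires. The tag 5 is
  that of \<open>RComp\<close>.\<close>

primrec const_num :: "nat \<Rightarrow> nat" where
  "const_num 0 = recf_num RZero"
| "const_num (Suc n) = \<langle>5, \<langle>recf_num RSucc, const_num n\<rangle>\<rangle>"

lemma const_num: "\<exists>p. recf_num p = const_num n \<and> (\<forall>x y. eval p x y \<longleftrightarrow> y = n)"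
proof (induction n)
  case 0
  show ?case by (rule exI[of _ RZero]) (auto intro: eval.zero elim: eval_elims)
next
  case (Suc n)
  then obtain p where "recf_num p = const_num n" "\<And>x y. eval p x y \<longleftrightarrow> y = n" by blast
  then show ?case
    by (intro exI[of _ "RComp RSucc p"]) (auto intro: eval.comp eval.succ elim!: eval_elims(6) eval_elims(2))
qed

lemma computable_const_num: "computable f \<Longrightarrow> computable (\<lambda>x. const_num (f x))"
  unfolding const_num_def by (intro comp_intros)

theorem recursion_theorem:
  assumes "semidecidable U"
  shows "\<exists>e. W e = {x. U \<langle>e, x\<rangle>}"
proof -
  from semidecidable_eval[OF assms] obtain p where p: "\<And>x. U x \<longleftrightarrow> (\<exists>y. eval p x y)" by blast
  \<comment> \<open>\<open>d q\<close> is the number of the program that on input \<open>x\<close>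
    runs program number \<open>q\<close> on \<open>\<langle>q, x\<rangle>\<close>. It is computed
    from \<open>q\<close> without decoding \<open>q\<close>.\<close>
  define d where "d q = \<langle>5, \<langle>q, \<langle>4, \<langle>const_num q, recf_num (RPair RFst RSnd)\<rangle>\<rangle>\<rangle>\<rangle>" for q
  have "computable (\<lambda>x. \<langle>d (\<pi>\<^sub>1 x), \<pi>\<^sub>2 x\<rangle>)"
    unfolding d_def by (intro comp_intros computable_const_num)
  then obtain r where r: "\<And>x. eval r x \<langle>d (\<pi>\<^sub>1 x), \<pi>\<^sub>2 x\<rangle>" unfolding computable_def by blast
  \<comment> \<open>For this \<open>q\<close>, program \<open>d q\<close> on \<open>x\<close> runs
    \<open>p\<close> after \<open>r\<close> on \<open>\<langle>q, x\<rangle>\<close>, that is,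
    \<open>p\<close> on \<open>\<langle>d q, x\<rangle>\<close>. So \<open>d q\<close> is the wanted
    fixed point.\<close>
  define q where "q = recf_num (RComp p r)"
  obtain s where s: "recf_num s = const_num q" "\<And>x y. eval s x y \<longleftrightarrow> y = q"
    using const_num by blast
  let ?e = "RComp (RComp p r) (RPair s (RPair RFst RSnd))"
  have e: "recf_num ?e = d q" by (simp add: d_def q_def s(1)[unfolded q_def])
  have id: "eval (RPair RFst RSnd) x y \<longleftrightarrow> y = x" for x y
    using eval.pair[OF eval.fst eval.snd, of "\<pi>\<^sub>1 x" "\<pi>\<^sub>2 x"] eval_deterministic by fastforce
  have 1: "eval (RPair s (RPair RFst RSnd)) x y \<longleftrightarrow> y = \<langle>q, x\<rangle>" for x y
  proof
    show "y = \<langle>q, x\<rangle>" if "eval (RPair s (RPair RFst RSnd)) x y"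
      using that by (rule eval_elims(5)) (simp add: s(2) id)
  qed (simp add: s(2) id eval.pair)
  have comp: "eval (RComp a b) x y \<longleftrightarrow> (\<exists>z. eval b x z \<and> eval a z y)" for a b x y
    by (blast intro: eval.comp elim: eval_elims(6))
  have r': "eval r x y \<longleftrightarrow> y = \<langle>d (\<pi>\<^sub>1 x), \<pi>\<^sub>2 x\<rangle>" for x y
    using r eval_deterministic by blast
  have 2: "(\<exists>y. eval (RComp p r) \<langle>q, x\<rangle> y) \<longleftrightarrow> (\<exists>y. eval p \<langle>d q, x\<rangle> y)" for x
    by (simp add: comp r')
  have "(\<exists>y. eval ?e x y) \<longleftrightarrow> (\<exists>y. eval (RComp p r) \<langle>q, x\<rangle> y)" for x
    using comp[of "RComp p r"] 1 by simp
  with 2 p have "(\<exists>y. eval ?e x y) \<longleftrightarrow> U \<langle>d q, x\<rangle>" for x by simp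
  moreover have "x \<in> W (d q) \<longleftrightarrow> (\<exists>y. eval ?e x y)" for x
    unfolding W_def e[symmetric] using recf_num_inject by blast
  ultimately show ?thesis by blast
qed

text \<open>The predicate ignores the index component, so the recursion theorem merely supplies an
  index.\<close>

lemma W_finite: 
  assumes "finite A"
  shows "\<exists>e. W e = A"
proof -
  have "semidecidable (\<lambda>z. \<pi>\<^sub>2 z \<in> A)"
    by (intro semidecidable_decidable comp_intros assms)
  from recursion_theorem[OF this] show ?thesis by simp
qed

section \<open>Derivability from decidable rules\<close>

text \<open>Programs, evaluations and terms are all generated by rules of this kind, so one search
  for coded derivations semidecides them all. The premises form a finite set so that derivations can
  be lists.\<close>

inductive_set derivable :: "(nat \<Rightarrow> nat set \<Rightarrow> bool) \<Rightarrow> nat set" for step where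
  derivableI: "finite A \<Longrightarrow> \<forall>x\<in>A. x \<in> derivable step \<Longrightarrow> step j A \<Longrightarrow> j \<in> derivable step"

text \<open>Every entry of a derivation follows from the entries after it.\<close>

primrec derivation :: "(nat \<Rightarrow> nat set \<Rightarrow> bool) \<Rightarrow> nat list \<Rightarrow> bool" where
  "derivation step [] \<longleftrightarrow> True"
| "derivation step (j # js) \<longleftrightarrow> step j (set js) \<and> derivation step js"

lemma derivation_sound: "derivation step js \<Longrightarrow> set js \<subseteq> derivable step"
proof (induction js)
  case (Cons j js)
  then have "j \<in> derivable step" by (intro derivableI[of "set js"]) auto
  with Cons show ?case by simp
qed simp

text \<open>An entry of \<open>js\<close> gains premises when \<open>ks\<close> is put behind it,
  which is harmless for a monotone \<open>step\<close>.\<close>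

lemma derivation_append:
  assumes "\<And>j A B. A \<subseteq> B \<Longrightarrow> step j A \<Longrightarrow> step j B"
  shows "derivation step js \<Longrightarrow> derivation step ks \<Longrightarrow> derivation step (js @ ks)"
  by (induction js) (auto intro: assms[rotated])

lemma derivation_complete:
  assumes mono: "\<And>j A B. A \<subseteq> B \<Longrightarrow> step j A \<Longrightarrow> step j B" and "j \<in> derivable step"
  shows "\<exists>js. derivation step js \<and> j \<in> set js"
  using assms(2)
proof induction
  case (derivableI A j)
  have "\<exists>js. derivation step js \<and> A \<subseteq> set js"
    using derivableI.hyps(1) derivableI.IH
  proof induction
    case (insert a A)
    then obtain js ks where "derivation step js" "A \<subseteq> set js" "derivation step ks" "a \<in> set ks"
      by auto
    then show ?case using derivation_append[of step ks js, OF mono] by (intro exI[of _ "ks @ js"]) auto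
  qed (auto intro: exI[of _ "[]"])
  then obtain js where "derivation step js" "A \<subseteq> set js" by blast
  with derivableI.hyps(2) show ?case by (intro exI[of _ "j # js"]) (auto intro: mono)
qed

text \<open>In this form entries and tails are read off by \<open>clsuf\<close>, and the condition
  becomes a bounded quantifier.\<close>

lemma derivation_nth:
  "derivation step js \<longleftrightarrow> (\<forall>i<length js. step (js ! i) (set (drop (Suc i) js)))"
proof (induction js)
  case (Cons j js)
  then show ?case by (auto simp: less_Suc_eq_0_disj)
qed simp

lemma semidecidable_derivable:
  assumes dec: "decidable (\<lambda>z. step (\<pi>\<^sub>1 z) (set (list_decode (\<pi>\<^sub>2 z))))"
    and mono: "\<And>j A B. A \<subseteq> B \<Longrightarrow> step j A \<Longrightarrow> step j B"
  shows "semidecidable (\<lambda>j. j \<in> derivable step)"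
proof (rule semidecidableI)
  let ?D = "\<lambda>l. \<forall>i<length (list_decode l). step (\<pi>\<^sub>1 (clsuf l i - 1)) (set (list_decode (clsuf l (Suc i))))"
  have D: "?D l \<longleftrightarrow> derivation step (list_decode l)" for l
    unfolding derivation_nth list_decode_clsuf using nth_clsuf(1)[of _ l] nth_clsuf(2)[of l] by auto
  have step: "decidable (\<lambda>z. step (f z) (set (list_decode (g z))))" if "computable f" "computable g" for f g
    using decidable_comp[OF dec computable_pair[OF that]] by simp
  show "decidable (\<lambda>z. ?D (\<pi>\<^sub>2 z) \<and> \<pi>\<^sub>1 z \<in> set (list_decode (\<pi>\<^sub>2 z)))"
    by (intro comp_intros step)
  show "j \<in> derivable step \<longleftrightarrow> (\<exists>l. ?D l \<and> j \<in> set (list_decode l))" for j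
    unfolding D
  proof
    assume "j \<in> derivable step"
    with mono have "\<exists>js. derivation step js \<and> j \<in> set js" by (rule derivation_complete)
    then obtain js where "derivation step js" "j \<in> set js" by blast
    then show "\<exists>l. derivation step (list_decode l) \<and> j \<in> set (list_decode l)"
      by (intro exI[of _ "list_encode js"]) simp
  qed (use derivation_sound in blast)
qed

section \<open>Enumerating the c.e. sets uniformly\<close>

text \<open>The tags are those of \<open>recf_num\<close>. A separate test for program numbers is
  needed: at recursion argument 0 the rule for \<open>RPrec\<close> never runs the second
  subprogram, so \<open>eval_step\<close> derives values also for some numbers that code no program,
  whose \<open>W\<close> is empty.\<close>

definition prog_step :: "nat \<Rightarrow> nat set \<Rightarrow> bool" where
  "prog_step j A \<longleftrightarrow>
    \<pi>\<^sub>1 j < 4 \<and> \<pi>\<^sub>2 j = 0 \<or>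
    \<pi>\<^sub>1 j \<in> {4, 5, 6} \<and> \<pi>\<^sub>1 (\<pi>\<^sub>2 j) \<in> A \<and> \<pi>\<^sub>2 (\<pi>\<^sub>2 j) \<in> A \<or>
    \<pi>\<^sub>1 j = 7 \<and> \<pi>\<^sub>2 j \<in> A"

lemma derivable_prog: "j \<in> derivable prog_step \<longleftrightarrow> j \<in> range recf_num"
proof
  assume "j \<in> derivable prog_step"
  then show "j \<in> range recf_num"
  proof induction
    case (derivableI A j)
    have j: "j = \<langle>\<pi>\<^sub>1 j, \<pi>\<^sub>2 j\<rangle>" "j = \<langle>\<pi>\<^sub>1 j, \<langle>\<pi>\<^sub>1 (\<pi>\<^sub>2 j), \<pi>\<^sub>2 (\<pi>\<^sub>2 j)\<rangle>\<rangle>" by simp_all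
    from derivableI.hyps(2) consider "\<pi>\<^sub>1 j = 0" "\<pi>\<^sub>2 j = 0" | "\<pi>\<^sub>1 j = 1" "\<pi>\<^sub>2 j = 0"
      | "\<pi>\<^sub>1 j = 2" "\<pi>\<^sub>2 j = 0" | "\<pi>\<^sub>1 j = 3" "\<pi>\<^sub>2 j = 0"
      | "\<pi>\<^sub>1 j = 4" "\<pi>\<^sub>1 (\<pi>\<^sub>2 j) \<in> A" "\<pi>\<^sub>2 (\<pi>\<^sub>2 j) \<in> A"
      | "\<pi>\<^sub>1 j = 5" "\<pi>\<^sub>1 (\<pi>\<^sub>2 j) \<in> A" "\<pi>\<^sub>2 (\<pi>\<^sub>2 j) \<in> A"
      | "\<pi>\<^sub>1 j = 6" "\<pi>\<^sub>1 (\<pi>\<^sub>2 j) \<in> A" "\<pi>\<^sub>2 (\<pi>\<^sub>2 j) \<in> A"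
      | "\<pi>\<^sub>1 j = 7" "\<pi>\<^sub>2 j \<in> A"
      unfolding prog_step_def by fastforce
    then show ?case
    proof cases
      case 1 then have "j = recf_num RZero" using j(1) by simp then show ?thesis by blast
    next
      case 2 then have "j = recf_num RSucc" using j(1) by simp then show ?thesis by blast
    next
      case 3 then have "j = recf_num RFst" using j(1) by simp then show ?thesis by blast
    next
      case 4 then have "j = recf_num RSnd" using j(1) by simp then show ?thesis by blast
    next
      case 5
      then obtain p q where "\<pi>\<^sub>1 (\<pi>\<^sub>2 j) = recf_num p" "\<pi>\<^sub>2 (\<pi>\<^sub>2 j) = recf_num q"
        using derivableI.IH by blast
      then have "j = recf_num (RPair p q)" using j(2) 5(1) by simp
      then show ?thesis by blast
    next
      case 6
      then obtain p q where "\<pi>\<^sub>1 (\<pi>\<^sub>2 j) = recf_num p" "\<pi>\<^sub>2 (\<pi>\<^sub>2 j) = recf_num q"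
        using derivableI.IH by blast
      then have "j = recf_num (RComp p q)" using j(2) 6(1) by simp
      then show ?thesis by blast
    next
      case 7
      then obtain p q where "\<pi>\<^sub>1 (\<pi>\<^sub>2 j) = recf_num p" "\<pi>\<^sub>2 (\<pi>\<^sub>2 j) = recf_num q"
        using derivableI.IH by blast
      then have "j = recf_num (RPrec p q)" using j(2) 7(1) by simp
      then show ?thesis by blast
    next
      case 8
      then obtain p where "\<pi>\<^sub>2 j = recf_num p" using derivableI.IH by blast
      then have "j = recf_num (RMu p)" using j(1) 8(1) by simp
      then show ?thesis by blast
    qed
  qed
next
  have "recf_num p \<in> derivable prog_step" for p
  proof (induction p)
    case RZero show ?case by (rule derivableI[of "{}"]) (auto simp: prog_step_def)
  next
    case RSucc show ?case by (rule derivableI[of "{}"]) (auto simp: prog_step_def)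
  next
    case RFst show ?case by (rule derivableI[of "{}"]) (auto simp: prog_step_def)
  next
    case RSnd show ?case by (rule derivableI[of "{}"]) (auto simp: prog_step_def)
  next
    case (RPair p q) then show ?case
      by (intro derivableI[of "{recf_num p, recf_num q}"]) (auto simp: prog_step_def)
  next
    case (RComp p q) then show ?case
      by (intro derivableI[of "{recf_num p, recf_num q}"]) (auto simp: prog_step_def)
  next
    case (RPrec p q) then show ?case
      by (intro derivableI[of "{recf_num p, recf_num q}"]) (auto simp: prog_step_def)
  next
    case (RMu p) then show ?case
      by (intro derivableI[of "{recf_num p}"]) (auto simp: prog_step_def)
  qed
  then show "j \<in> range recf_num \<Longrightarrow> j \<in> derivable prog_step" by blast
qed

lemma semidecidable_prog: "semidecidable (\<lambda>j. j \<in> range recf_num)"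
  unfolding derivable_prog[symmetric]
proof (rule semidecidable_derivable)
  show "decidable (\<lambda>z. prog_step (\<pi>\<^sub>1 z) (set (list_decode (\<pi>\<^sub>2 z))))"
    unfolding prog_step_def by (intro comp_intros finite.intros)
qed (auto simp: prog_step_def)

text \<open>The judgement \<open>eval p x y\<close> is coded as \<open>\<langle>recf_num p, \<langle>x, y\<rangle>\<rangle>\<close>.\<close>

definition eval_step :: "nat \<Rightarrow> nat set \<Rightarrow> bool" where
  "eval_step j A \<longleftrightarrow>
    \<pi>\<^sub>1 j = recf_num RZero \<and> \<pi>\<^sub>2 (\<pi>\<^sub>2 j) = 0 \<or>
    \<pi>\<^sub>1 j = recf_num RSucc \<and> \<pi>\<^sub>2 (\<pi>\<^sub>2 j) = Suc (\<pi>\<^sub>1 (\<pi>\<^sub>2 j)) \<or>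
    \<pi>\<^sub>1 j = recf_num RFst \<and> \<pi>\<^sub>2 (\<pi>\<^sub>2 j) = \<pi>\<^sub>1 (\<pi>\<^sub>1 (\<pi>\<^sub>2 j)) \<or>
    \<pi>\<^sub>1 j = recf_num RSnd \<and> \<pi>\<^sub>2 (\<pi>\<^sub>2 j) = \<pi>\<^sub>2 (\<pi>\<^sub>1 (\<pi>\<^sub>2 j)) \<or>
    \<pi>\<^sub>1 (\<pi>\<^sub>1 j) = 4 \<and> \<langle>\<pi>\<^sub>1 (\<pi>\<^sub>2 (\<pi>\<^sub>1 j)), \<langle>\<pi>\<^sub>1 (\<pi>\<^sub>2 j), \<pi>\<^sub>1 (\<pi>\<^sub>2 (\<pi>\<^sub>2 j))\<rangle>\<rangle> \<in> A \<and>
      \<langle>\<pi>\<^sub>2 (\<pi>\<^sub>2 (\<pi>\<^sub>1 j)), \<langle>\<pi>\<^sub>1 (\<pi>\<^sub>2 j), \<pi>\<^sub>2 (\<pi>\<^sub>2 (\<pi>\<^sub>2 j))\<rangle>\<rangle> \<in> A \<or>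
    \<pi>\<^sub>1 (\<pi>\<^sub>1 j) = 5 \<and> (\<exists>i\<in>A. \<pi>\<^sub>1 i = \<pi>\<^sub>2 (\<pi>\<^sub>2 (\<pi>\<^sub>1 j)) \<and> \<pi>\<^sub>1 (\<pi>\<^sub>2 i) = \<pi>\<^sub>1 (\<pi>\<^sub>2 j) \<and>
      \<langle>\<pi>\<^sub>1 (\<pi>\<^sub>2 (\<pi>\<^sub>1 j)), \<langle>\<pi>\<^sub>2 (\<pi>\<^sub>2 i), \<pi>\<^sub>2 (\<pi>\<^sub>2 j)\<rangle>\<rangle> \<in> A) \<or>
    \<pi>\<^sub>1 (\<pi>\<^sub>1 j) = 6 \<and> \<pi>\<^sub>2 (\<pi>\<^sub>1 (\<pi>\<^sub>2 j)) = 0 \<and>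
      \<langle>\<pi>\<^sub>1 (\<pi>\<^sub>2 (\<pi>\<^sub>1 j)), \<langle>\<pi>\<^sub>1 (\<pi>\<^sub>1 (\<pi>\<^sub>2 j)), \<pi>\<^sub>2 (\<pi>\<^sub>2 j)\<rangle>\<rangle> \<in> A \<or>
    \<pi>\<^sub>1 (\<pi>\<^sub>1 j) = 6 \<and> 0 < \<pi>\<^sub>2 (\<pi>\<^sub>1 (\<pi>\<^sub>2 j)) \<and> (\<exists>i\<in>A. \<pi>\<^sub>1 i = \<pi>\<^sub>1 j \<and>
      \<pi>\<^sub>1 (\<pi>\<^sub>2 i) = \<langle>\<pi>\<^sub>1 (\<pi>\<^sub>1 (\<pi>\<^sub>2 j)), \<pi>\<^sub>2 (\<pi>\<^sub>1 (\<pi>\<^sub>2 j)) - 1\<rangle> \<and>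
      \<langle>\<pi>\<^sub>2 (\<pi>\<^sub>2 (\<pi>\<^sub>1 j)), \<langle>\<langle>\<pi>\<^sub>1 (\<pi>\<^sub>1 (\<pi>\<^sub>2 j)), \<langle>\<pi>\<^sub>2 (\<pi>\<^sub>1 (\<pi>\<^sub>2 j)) - 1, \<pi>\<^sub>2 (\<pi>\<^sub>2 i)\<rangle>\<rangle>, \<pi>\<^sub>2 (\<pi>\<^sub>2 j)\<rangle>\<rangle> \<in> A) \<or>
    \<pi>\<^sub>1 (\<pi>\<^sub>1 j) = 7 \<and> \<langle>\<pi>\<^sub>2 (\<pi>\<^sub>1 j), \<langle>\<pi>\<^sub>2 j, 0\<rangle>\<rangle> \<in> A \<and>
      (\<forall>m<\<pi>\<^sub>2 (\<pi>\<^sub>2 j). \<exists>i\<in>A. \<pi>\<^sub>1 i = \<pi>\<^sub>2 (\<pi>\<^sub>1 j) \<and> \<pi>\<^sub>1 (\<pi>\<^sub>2 i) = \<langle>\<pi>\<^sub>1 (\<pi>\<^sub>2 j), m\<rangle> \<and> 0 < \<pi>\<^sub>2 (\<pi>\<^sub>2 i))"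

lemma eval_step_mono: "A \<subseteq> B \<Longrightarrow> eval_step j A \<Longrightarrow> eval_step j B"
  unfolding eval_step_def by (elim disj_forward) blast+

lemma decidable_eval_step: "decidable (\<lambda>z. eval_step (\<pi>\<^sub>1 z) (set (list_decode (\<pi>\<^sub>2 z))))"
  unfolding eval_step_def by (intro comp_intros)

lemma derivable_eval_complete: "eval p x y \<Longrightarrow> \<langle>recf_num p, \<langle>x, y\<rangle>\<rangle> \<in> derivable eval_step"
proof (induction rule: eval.induct)
  case (pair p x a q b)
  then show ?case
    by (intro derivableI[of "{\<langle>recf_num p, \<langle>x, a\<rangle>\<rangle>, \<langle>recf_num q, \<langle>x, b\<rangle>\<rangle>}"])
      (simp_all add: eval_step_def)
next
  case (comp q x y p z)
  then show ?case
    by (intro derivableI[of "{\<langle>recf_num q, \<langle>x, y\<rangle>\<rangle>, \<langle>recf_num p, \<langle>y, z\<rangle>\<rangle>}"])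
      (simp_all add: eval_step_def)
next
  case (prec_0 p a y q)
  then show ?case
    by (intro derivableI[of "{\<langle>recf_num p, \<langle>a, y\<rangle>\<rangle>}"]) (simp_all add: eval_step_def)
next
  case (prec_Suc p q a n y z)
  then show ?case
    by (intro derivableI[of "{\<langle>recf_num (RPrec p q), \<langle>\<langle>a, n\<rangle>, y\<rangle>\<rangle>,
        \<langle>recf_num q, \<langle>\<langle>a, \<langle>n, y\<rangle>\<rangle>, z\<rangle>\<rangle>}"])
      (simp_all add: eval_step_def)
next
  case (mu p x n)
  then obtain k where k: "\<And>m. m < n \<Longrightarrow> \<langle>recf_num p, \<langle>\<langle>x, m\<rangle>, Suc (k m)\<rangle>\<rangle> \<in> derivable eval_step"
    by metis
  let ?A = "insert \<langle>recf_num p, \<langle>\<langle>x, n\<rangle>, 0\<rangle>\<rangle>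
      ((\<lambda>m. \<langle>recf_num p, \<langle>\<langle>x, m\<rangle>, Suc (k m)\<rangle>\<rangle>) ` {..<n})"
  show ?case
  proof (rule derivableI[of ?A])
    show "eval_step \<langle>recf_num (RMu p), \<langle>x, n\<rangle>\<rangle> ?A" by (auto simp: eval_step_def)
  qed (use k mu.IH(1) in auto)
qed (rule derivableI[of "{}"]; simp add: eval_step_def)+

text \<open>Soundness is claimed only for judgements about program numbers. The shape of
  \<open>p\<close> then fixes the tag in \<open>eval_step\<close>, and the subprograms have program
  numbers again, so the induction hypothesis applies to them.\<close>

lemma derivable_eval_sound:
  "j \<in> derivable eval_step \<Longrightarrow> \<pi>\<^sub>1 j = recf_num p \<Longrightarrow> eval p (\<pi>\<^sub>1 (\<pi>\<^sub>2 j)) (\<pi>\<^sub>2 (\<pi>\<^sub>2 j))"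
proof (induction arbitrary: p rule: derivable.induct)
  case (derivableI A j)
  define x y where xy: "x = \<pi>\<^sub>1 (\<pi>\<^sub>2 j)" "y = \<pi>\<^sub>2 (\<pi>\<^sub>2 j)"
  have IH: "eval q (\<pi>\<^sub>1 (\<pi>\<^sub>2 i)) (\<pi>\<^sub>2 (\<pi>\<^sub>2 i))" if "i \<in> A" "\<pi>\<^sub>1 i = recf_num q" for i q
    using derivableI.IH that by blast
  have IH': "eval q u v" if "\<langle>recf_num q, \<langle>u, v\<rangle>\<rangle> \<in> A" for q u v
    using IH[OF that, of q] by simp
  have x: "\<langle>\<pi>\<^sub>1 x, \<pi>\<^sub>2 x\<rangle> = x" by simp
  have y: "\<langle>\<pi>\<^sub>1 y, \<pi>\<^sub>2 y\<rangle> = y" by simp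
  note st = derivableI.hyps(2)[unfolded eval_step_def derivableI.prems xy[symmetric]]
  have "eval p x y"
  proof (cases p)
    case RZero
    then show ?thesis using st by (auto intro: eval.zero)
  next
    case RSucc
    then show ?thesis using st by (auto intro: eval.succ)
  next
    case RFst
    then have "y = \<pi>\<^sub>1 x" using st by auto
    then show ?thesis using eval.fst[of "\<pi>\<^sub>1 x" "\<pi>\<^sub>2 x"] RFst by simp
  next
    case RSnd
    then have "y = \<pi>\<^sub>2 x" using st by auto
    then show ?thesis using eval.snd[of "\<pi>\<^sub>1 x" "\<pi>\<^sub>2 x"] RSnd by simp
  next
    case (RPair q r)
    then have "eval q x (\<pi>\<^sub>1 y)" "eval r x (\<pi>\<^sub>2 y)" using st by (auto intro: IH')
    from eval.pair[OF this] show ?thesis using RPair by simp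
  next
    case (RComp q r)
    then obtain i where "i \<in> A" "\<pi>\<^sub>1 i = recf_num r" "\<pi>\<^sub>1 (\<pi>\<^sub>2 i) = x"
      "\<langle>recf_num q, \<langle>\<pi>\<^sub>2 (\<pi>\<^sub>2 i), y\<rangle>\<rangle> \<in> A" using st by auto
    then show ?thesis unfolding RComp using IH[of i r] by (auto intro: eval.comp IH')
  next
    case (RPrec q r)
    show ?thesis
    proof (cases "\<pi>\<^sub>2 x")
      case 0
      then have "eval q (\<pi>\<^sub>1 x) y" using st RPrec by (auto intro: IH')
      from eval.prec_0[OF this] show ?thesis unfolding RPrec using x 0 by metis
    next
      case (Suc n)
      then obtain i where "i \<in> A" "\<pi>\<^sub>1 i = recf_num p" "\<pi>\<^sub>1 (\<pi>\<^sub>2 i) = \<langle>\<pi>\<^sub>1 x, n\<rangle>"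
        "\<langle>recf_num r, \<langle>\<langle>\<pi>\<^sub>1 x, \<langle>n, \<pi>\<^sub>2 (\<pi>\<^sub>2 i)\<rangle>\<rangle>, y\<rangle>\<rangle> \<in> A" using st RPrec by auto
      then have "eval (RPrec q r) \<langle>\<pi>\<^sub>1 x, n\<rangle> (\<pi>\<^sub>2 (\<pi>\<^sub>2 i))" "eval r \<langle>\<pi>\<^sub>1 x, \<langle>n, \<pi>\<^sub>2 (\<pi>\<^sub>2 i)\<rangle>\<rangle> y"
        using IH[of i p] RPrec by (auto intro: IH')
      from eval.prec_Suc[OF this] show ?thesis unfolding RPrec using x Suc by metis
    qed
  next
    case (RMu q)
    have "\<pi>\<^sub>2 j = \<langle>x, y\<rangle>" unfolding xy by simp
    with RMu st have "\<langle>recf_num q, \<langle>\<langle>x, y\<rangle>, 0\<rangle>\<rangle> \<in> A"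
      and less: "\<forall>m<y. \<exists>i\<in>A. \<pi>\<^sub>1 i = recf_num q \<and> \<pi>\<^sub>1 (\<pi>\<^sub>2 i) = \<langle>x, m\<rangle> \<and> 0 < \<pi>\<^sub>2 (\<pi>\<^sub>2 i)"
      by auto
    have "\<exists>k. eval q \<langle>x, m\<rangle> (Suc k)" if m: "m < y" for m
    proof -
      from less m obtain i where "i \<in> A" "\<pi>\<^sub>1 i = recf_num q" "\<pi>\<^sub>1 (\<pi>\<^sub>2 i) = \<langle>x, m\<rangle>"
        "0 < \<pi>\<^sub>2 (\<pi>\<^sub>2 i)" by blast
      then show ?thesis using IH[of i q] by (metis Suc_pred)
    qed
    then show ?thesis unfolding RMu using \<open>\<langle>recf_num q, \<langle>\<langle>x, y\<rangle>, 0\<rangle>\<rangle> \<in> A\<close>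
      by (intro eval.mu IH') auto
  qed
  then show ?case by (simp only: xy)
qed

lemma W_derivable: "x \<in> W e \<longleftrightarrow> e \<in> range recf_num \<and> (\<exists>y. \<langle>e, \<langle>x, y\<rangle>\<rangle> \<in> derivable eval_step)"
proof
  assume "x \<in> W e"
  then show "e \<in> range recf_num \<and> (\<exists>y. \<langle>e, \<langle>x, y\<rangle>\<rangle> \<in> derivable eval_step)"
    unfolding W_def by (auto intro: derivable_eval_complete)
next
  assume "e \<in> range recf_num \<and> (\<exists>y. \<langle>e, \<langle>x, y\<rangle>\<rangle> \<in> derivable eval_step)"
  then obtain p y where "e = recf_num p" "\<langle>e, \<langle>x, y\<rangle>\<rangle> \<in> derivable eval_step" by blast
  then have "eval p x y" using derivable_eval_sound[of "\<langle>e, \<langle>x, y\<rangle>\<rangle>" p] by simp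
  then show "x \<in> W e" unfolding W_def using \<open>e = recf_num p\<close> by blast
qed

lemma semidecidable_W:
  assumes "computable f" "computable g"
  shows "semidecidable (\<lambda>x. f x \<in> W (g x))"
proof -
  have "semidecidable (\<lambda>x. g x \<in> range recf_num)"
    by (rule semidecidable_comp[OF semidecidable_prog assms(2)])
  moreover have "semidecidable (\<lambda>j. j \<in> derivable eval_step)"
    by (rule semidecidable_derivable[OF decidable_eval_step eval_step_mono])
  then have "semidecidable (\<lambda>x. \<exists>y. \<langle>g x, \<langle>f x, y\<rangle>\<rangle> \<in> derivable eval_step)"
    by (intro semidecidable_ex, elim semidecidable_comp)
      (intro comp_intros computable_comp[OF assms(1)] computable_comp[OF assms(2)])
  ultimately show ?thesis unfolding W_derivable by (rule semidecidable_conj)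
qed

section \<open>Term codes\<close>

text \<open>\<open>\<langle>k, m\<rangle>\<close> stands for the judgement that \<open>m\<close> codes a term over the first \<open>k\<close> variables.\<close>

definition term_step :: "signature \<Rightarrow> nat \<Rightarrow> nat set \<Rightarrow> bool" where
  "term_step sig j A \<longleftrightarrow>
    \<pi>\<^sub>1 (\<pi>\<^sub>2 j) = 0 \<and> \<pi>\<^sub>2 (\<pi>\<^sub>2 j) < \<pi>\<^sub>1 j \<or>
    0 < \<pi>\<^sub>1 (\<pi>\<^sub>2 j) \<and>
    \<langle>\<pi>\<^sub>1 (\<pi>\<^sub>2 j) - 1, length (list_decode (\<pi>\<^sub>2 (\<pi>\<^sub>2 j)))\<rangle> \<in> {\<langle>f, sig ! f\<rangle> | f. f < length sig} \<and>
    (\<forall>m<\<pi>\<^sub>2 (\<pi>\<^sub>2 j). m \<in> set (list_decode (\<pi>\<^sub>2 (\<pi>\<^sub>2 j))) \<longrightarrow> \<langle>\<pi>\<^sub>1 j, m\<rangle> \<in> A)"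

lemma derivable_term:
  "\<langle>k, m\<rangle> \<in> derivable (term_step sig) \<longleftrightarrow> m \<in> trm_num ` terms sig {..<k}"
proof
  have "\<pi>\<^sub>2 j \<in> trm_num ` terms sig {..<\<pi>\<^sub>1 j}" if "j \<in> derivable (term_step sig)" for j
    using that
  proof induction
    case (derivableI A j)
    from derivableI.hyps(2) consider "\<pi>\<^sub>1 (\<pi>\<^sub>2 j) = 0" "\<pi>\<^sub>2 (\<pi>\<^sub>2 j) < \<pi>\<^sub>1 j"
      | f where "\<pi>\<^sub>1 (\<pi>\<^sub>2 j) = Suc f" "f < length sig" "length (list_decode (\<pi>\<^sub>2 (\<pi>\<^sub>2 j))) = sig ! f"
        "\<forall>m\<in>set (list_decode (\<pi>\<^sub>2 (\<pi>\<^sub>2 j))). \<langle>\<pi>\<^sub>1 j, m\<rangle> \<in> A"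
      unfolding term_step_def
    proof (elim disjE conjE)
      assume *: "\<forall>m<\<pi>\<^sub>2 (\<pi>\<^sub>2 j). m \<in> set (list_decode (\<pi>\<^sub>2 (\<pi>\<^sub>2 j))) \<longrightarrow> \<langle>\<pi>\<^sub>1 j, m\<rangle> \<in> A"
        and "0 < \<pi>\<^sub>1 (\<pi>\<^sub>2 j)"
        and "\<langle>\<pi>\<^sub>1 (\<pi>\<^sub>2 j) - 1, length (list_decode (\<pi>\<^sub>2 (\<pi>\<^sub>2 j)))\<rangle> \<in> {\<langle>f, sig ! f\<rangle> | f. f < length sig}"
      moreover define f where "f = \<pi>\<^sub>1 (\<pi>\<^sub>2 j) - 1"
      ultimately have "\<pi>\<^sub>1 (\<pi>\<^sub>2 j) = Suc f" "f < length sig"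
        "length (list_decode (\<pi>\<^sub>2 (\<pi>\<^sub>2 j))) = sig ! f" by auto
      with * show ?thesis using less_list_code that(2) by blast
    qed (rule that(1))
    then show ?case
    proof cases
      case 1
      then have "\<pi>\<^sub>2 j = trm_num (Var (\<pi>\<^sub>2 (\<pi>\<^sub>2 j)))" using cpair_surj[of "\<pi>\<^sub>2 j"] by simp
      with 1 show ?thesis by (metis imageI lessThan_iff terms.intros(1))
    next
      case (2 f)
      have "\<forall>m\<in>set (list_decode (\<pi>\<^sub>2 (\<pi>\<^sub>2 j))). m \<in> trm_num ` terms sig {..<\<pi>\<^sub>1 j}"
        using derivableI.IH 2(4) by fastforce
      \<comment> \<open>All entries are codes of terms, so the list itself is the image of a list of
        terms.\<close>
      then have "list_decode (\<pi>\<^sub>2 (\<pi>\<^sub>2 j)) \<in> map trm_num ` lists (terms sig {..<\<pi>\<^sub>1 j})"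
        unfolding lists_image[symmetric] by auto
      then obtain ts where ts: "list_decode (\<pi>\<^sub>2 (\<pi>\<^sub>2 j)) = map trm_num ts"
        "set ts \<subseteq> terms sig {..<\<pi>\<^sub>1 j}" by auto
      then have "\<pi>\<^sub>2 j = trm_num (Fn f ts)"
        using 2(1) cpair_surj[of "\<pi>\<^sub>2 j"] list_decode_inverse[of "\<pi>\<^sub>2 (\<pi>\<^sub>2 j)"] by simp
      moreover have "Fn f ts \<in> terms sig {..<\<pi>\<^sub>1 j}"
        using ts 2(2,3) by (intro terms.intros(2)) auto
      ultimately show ?thesis by blast
    qed
  qed
  then show "\<langle>k, m\<rangle> \<in> derivable (term_step sig) \<Longrightarrow> m \<in> trm_num ` terms sig {..<k}" by fastforce
next
  have "\<langle>k, trm_num t\<rangle> \<in> derivable (term_step sig)" if "t \<in> terms sig {..<k}" for t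
    using that
  proof induction
    case (1 i)
    then show ?case by (intro derivableI[of "{}"]) (auto simp: term_step_def)
  next
    case (2 f ts)
    then show ?case
      by (intro derivableI[of "(\<lambda>t. \<langle>k, trm_num t\<rangle>) ` set ts"]) (auto simp: term_step_def)
  qed
  then show "m \<in> trm_num ` terms sig {..<k} \<Longrightarrow> \<langle>k, m\<rangle> \<in> derivable (term_step sig)" by blast
qed

lemma semidecidable_term:
  assumes "computable f" "computable g"
  shows "semidecidable (\<lambda>x. g x \<in> trm_num ` terms sig {..<f x})"
proof -
  have "semidecidable (\<lambda>j. j \<in> derivable (term_step sig))"
  proof (rule semidecidable_derivable)
    \<comment> \<open>Finiteness of the signature enters here: the arities form a finite table, so
      looking up an arity is decidable.\<close>
    have "{\<langle>f, sig ! f\<rangle> | f. f < length sig} = (\<lambda>f. \<langle>f, sig ! f\<rangle>) ` {..<length sig}" by auto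
    then have *: "finite {\<langle>f, sig ! f\<rangle> | f. f < length sig}" by simp
    show "decidable (\<lambda>z. term_step sig (\<pi>\<^sub>1 z) (set (list_decode (\<pi>\<^sub>2 z))))"
      unfolding term_step_def by (intro comp_intros *)
  qed (auto simp: term_step_def)
  from semidecidable_comp[OF this computable_pair[OF assms]] show ?thesis
    unfolding derivable_term .
qed

lemma semidecidable_pairs:
  assumes "computable f" "computable g"
  shows "semidecidable (\<lambda>x. g x \<in> pair_num ` pairs sig (f x))"
proof -
  have "m \<in> pair_num ` pairs sig k \<longleftrightarrow>
      \<pi>\<^sub>1 m \<in> trm_num ` terms sig {..<k} \<and> \<pi>\<^sub>2 m \<in> trm_num ` terms sig {..<k}" (is "?l \<longleftrightarrow> ?r") for m k
  proof
    assume ?r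
    then obtain s t where "\<pi>\<^sub>1 m = trm_num s" "\<pi>\<^sub>2 m = trm_num t" "(s, t) \<in> pairs sig k"
      unfolding pairs_def by auto
    then have "m = pair_num (s, t)" using cpair_surj[of m] by (simp add: pair_num_def)
    with \<open>(s, t) \<in> pairs sig k\<close> show ?l by blast
  qed (auto simp: pair_num_def pairs_def)
  then show ?thesis
    using assms by (simp add: semidecidable_conj semidecidable_term comp_intros)
qed

section \<open>Congruences and quotients\<close>

lemma congruenceD:
  assumes "congruence sig A \<theta>"
  shows "(a, b) \<in> \<theta> \<Longrightarrow> a \<in> carrier A" "(a, b) \<in> \<theta> \<Longrightarrow> b \<in> carrier A"
    "a \<in> carrier A \<Longrightarrow> (a, a) \<in> \<theta>" "(a, b) \<in> \<theta> \<Longrightarrow> (b, a) \<in> \<theta>"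
    "(a, b) \<in> \<theta> \<Longrightarrow> (b, c) \<in> \<theta> \<Longrightarrow> (a, c) \<in> \<theta>"
    "f < length sig \<Longrightarrow> length xs = sig ! f \<Longrightarrow> list_all2 (\<lambda>x y. (x, y) \<in> \<theta>) xs ys \<Longrightarrow>
      (op A f xs, op A f ys) \<in> \<theta>"
  using assms unfolding congruence_def equiv_def refl_on_def sym_def trans_def by blast+

lemma congruenceI:
  assumes "\<And>a b. (a, b) \<in> \<theta> \<Longrightarrow> a \<in> carrier A \<and> b \<in> carrier A"
    and "\<And>a. a \<in> carrier A \<Longrightarrow> (a, a) \<in> \<theta>" "\<And>a b. (a, b) \<in> \<theta> \<Longrightarrow> (b, a) \<in> \<theta>"
    and "\<And>a b c. (a, b) \<in> \<theta> \<Longrightarrow> (b, c) \<in> \<theta> \<Longrightarrow> (a, c) \<in> \<theta>"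
    and "\<And>f xs ys. f < length sig \<Longrightarrow> length xs = sig ! f \<Longrightarrow> list_all2 (\<lambda>x y. (x, y) \<in> \<theta>) xs ys \<Longrightarrow>
      (op A f xs, op A f ys) \<in> \<theta>"
  shows "congruence sig A \<theta>"
  unfolding congruence_def
proof (intro conjI equivI allI impI)
  show "\<theta> \<subseteq> carrier A \<times> carrier A" using assms(1) by auto
  show "refl_on (carrier A) \<theta>" using assms(2) by (auto simp: refl_on_def)
  show "sym \<theta>" using assms(3) by (auto simp: sym_def)
  show "trans \<theta>" using assms(4) by (auto simp: trans_def)
qed (use assms(5) in blast)

lemma class_eq_iff:
  assumes "congruence sig A \<theta>" "a \<in> carrier A" "b \<in> carrier A"
  shows "\<theta> `` {a} = \<theta> `` {b} \<longleftrightarrow> (a, b) \<in> \<theta>"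
  using assms unfolding congruence_def by (intro eq_equiv_class_iff) auto

definition closed :: "signature \<Rightarrow> 'a algebra \<Rightarrow> bool" where
  "closed sig A \<longleftrightarrow> (\<forall>f<length sig. \<forall>xs. length xs = sig ! f \<longrightarrow> set xs \<subseteq> carrier A \<longrightarrow>
    op A f xs \<in> carrier A)"

lemma closedD:
  "closed sig A \<Longrightarrow> f < length sig \<Longrightarrow> length xs = sig ! f \<Longrightarrow> set xs \<subseteq> carrier A \<Longrightarrow>
    op A f xs \<in> carrier A"
  unfolding closed_def by blast

text \<open>A congruence lies within the carrier, and compatibility applied to \<open>xs\<close>
  paired with itself puts \<open>op A f xs\<close> there.\<close>

lemma congruence_closed:
  assumes "congruence sig A \<theta>"
  shows "closed sig A"
  unfolding closed_def
proof (intro allI impI)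
  fix f xs assume *: "f < length sig" "length xs = sig ! f" "set xs \<subseteq> carrier A"
  have "list_all2 (\<lambda>x y. (x, y) \<in> \<theta>) xs xs"
    unfolding list_all2_same using *(3) congruenceD(3)[OF assms] by blast
  then show "op A f xs \<in> carrier A" using congruenceD(1,6)[OF assms] *(1,2) by metis
qed

lemma carrier_quotient: "carrier (quotient_algebra A \<theta>) = carrier A // \<theta>"
  by (simp add: quotient_algebra_def)

text \<open>\<open>quotient_algebra\<close> unites the classes of the results over all choices of
  representatives. By compatibility these classes agree, and reflexivity provides at least one
  choice.\<close>

lemma op_quotient:
  assumes \<theta>: "congruence sig A \<theta>" and f: "f < length sig" "length xs = sig ! f" "set xs \<subseteq> carrier A"
  shows "op (quotient_algebra A \<theta>) f (map (\<lambda>x. \<theta> `` {x}) xs) = \<theta> `` {op A f xs}"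
proof -
  have xs: "list_all2 (\<in>) xs (map (\<lambda>x. \<theta> `` {x}) xs)"
    using f(3) congruenceD(3)[OF \<theta>] by (auto simp: list_all2_conv_all_nth subset_iff)
  have eq: "\<theta> `` {op A f ys} = \<theta> `` {op A f xs}" if "list_all2 (\<in>) ys (map (\<lambda>x. \<theta> `` {x}) xs)" for ys
  proof -
    have "list_all2 (\<lambda>x y. (x, y) \<in> \<theta>) xs ys"
      using that by (auto simp: list_all2_conv_all_nth)
    then have *: "(op A f xs, op A f ys) \<in> \<theta>" using congruenceD(6)[OF \<theta>] f by blast
    then show ?thesis using class_eq_iff[OF \<theta>] congruenceD(1,2)[OF \<theta> *] by metis
  qed
  have "(\<Union>ys\<in>{ys. list_all2 (\<in>) ys (map (\<lambda>x. \<theta> `` {x}) xs)}. \<theta> `` {op A f ys}) = \<theta> `` {op A f xs}"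
  proof (rule UN_constant_eq)
    show "xs \<in> {ys. list_all2 (\<in>) ys (map (\<lambda>x. \<theta> `` {x}) xs)}" using xs by simp
  qed (use eq in blast)
  moreover have "op (quotient_algebra A \<theta>) f Cs = (\<Union>ys\<in>{ys. list_all2 (\<in>) ys Cs}. \<theta> `` {op A f ys})" for Cs
    unfolding quotient_algebra_def by auto
  ultimately show ?thesis by simp
qed

lemma quotient_lift:
  "set Cs \<subseteq> carrier A // \<theta> \<Longrightarrow> \<exists>xs. Cs = map (\<lambda>x. \<theta> `` {x}) xs \<and> set xs \<subseteq> carrier A"
proof (induction Cs)
  case (Cons C Cs)
  then obtain x xs where "C = \<theta> `` {x}" "x \<in> carrier A" "Cs = map (\<lambda>x. \<theta> `` {x}) xs" "set xs \<subseteq> carrier A"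
    by (auto elim!: quotientE)
  then show ?case by (intro exI[of _ "x # xs"]) simp
qed simp

lemma closed_quotient:
  assumes \<theta>: "congruence sig A \<theta>"
  shows "closed sig (quotient_algebra A \<theta>)"
  unfolding closed_def carrier_quotient
proof (intro allI impI)
  fix f Cs assume *: "f < length sig" "length Cs = sig ! f" "set Cs \<subseteq> carrier A // \<theta>"
  then obtain xs where xs: "Cs = map (\<lambda>x. \<theta> `` {x}) xs" "set xs \<subseteq> carrier A"
    using quotient_lift by blast
  then have "op (quotient_algebra A \<theta>) f Cs = \<theta> `` {op A f xs}"
    using op_quotient[OF \<theta>] * by simp
  moreover have "op A f xs \<in> carrier A"
    using closedD[OF congruence_closed[OF \<theta>]] * xs by simp
  ultimately show "op (quotient_algebra A \<theta>) f Cs \<in> carrier A // \<theta>"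
    by (simp add: quotientI)
qed

section \<open>Isomorphisms between quotients\<close>

lemma isomorphic_refl: "isomorphic sig A A"
  unfolding isomorphic_def by (rule exI[of _ id]) simp

lemma isomorphic_trans:
  assumes "isomorphic sig A B" "isomorphic sig B C"
  shows "isomorphic sig A C"
proof -
  from assms obtain \<phi> \<psi> where bij: "bij_betw \<phi> (carrier A) (carrier B)" "bij_betw \<psi> (carrier B) (carrier C)"
    and hom: "\<And>f xs. f < length sig \<Longrightarrow> length xs = sig ! f \<Longrightarrow> set xs \<subseteq> carrier A \<Longrightarrow>
       \<phi> (op A f xs) = op B f (map \<phi> xs)"
     "\<And>f xs. f < length sig \<Longrightarrow> length xs = sig ! f \<Longrightarrow> set xs \<subseteq> carrier B \<Longrightarrow>
       \<psi> (op B f xs) = op C f (map \<psi> xs)"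
    unfolding isomorphic_def by blast
  have "set (map \<phi> xs) \<subseteq> carrier B" if "set xs \<subseteq> carrier A" for xs
    using that bij_betw_imp_surj_on[OF bij(1)] by auto
  then show ?thesis
    unfolding isomorphic_def using bij_betw_trans[OF bij] hom
    by (intro exI[of _ "\<psi> \<circ> \<phi>"]) simp
qed

text \<open>The inverse map cancels against the image of \<open>op A f xs\<close> only if this value
  lies in the carrier, hence the closedness assumption.\<close>

lemma isomorphic_sym:
  assumes "closed sig A" "isomorphic sig A B"
  shows "isomorphic sig B A"
proof -
  from assms(2) obtain \<phi> where bij: "bij_betw \<phi> (carrier A) (carrier B)"
    and hom: "\<And>f xs. f < length sig \<Longrightarrow> length xs = sig ! f \<Longrightarrow> set xs \<subseteq> carrier A \<Longrightarrow>
       \<phi> (op A f xs) = op B f (map \<phi> xs)"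
    unfolding isomorphic_def by blast
  let ?\<psi> = "inv_into (carrier A) \<phi>"
  have "?\<psi> (op B f ys) = op A f (map ?\<psi> ys)"
    if f: "f < length sig" "length ys = sig ! f" "set ys \<subseteq> carrier B" for f ys
  proof -
    have xs: "set (map ?\<psi> ys) \<subseteq> carrier A"
      using f(3) bij_betw_imp_surj_on[OF bij_betw_inv_into[OF bij]] by auto
    have "map \<phi> (map ?\<psi> ys) = ys"
      using f(3) bij_betw_inv_into_right[OF bij] by (simp add: map_idI subset_iff)
    then have "op B f ys = \<phi> (op A f (map ?\<psi> ys))" using hom[of f "map ?\<psi> ys"] f xs by simp
    moreover have "op A f (map ?\<psi> ys) \<in> carrier A" using closedD[OF assms(1)] f xs by simp
    ultimately show ?thesis using bij_betw_inv_into_left[OF bij] by simp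
  qed
  then show ?thesis
    unfolding isomorphic_def using bij_betw_inv_into[OF bij] by blast
qed

text \<open>Isomorphisms between quotients are handled on representatives. The second clause makes
  the induced map well defined and injective, the third makes it surjective, and operations are
  respected only modulo \<open>\<eta>\<close>.\<close>

definition represents_iso ::
    "signature \<Rightarrow> 'a algebra \<Rightarrow> 'a rel \<Rightarrow> 'b algebra \<Rightarrow> 'b rel \<Rightarrow> ('a \<Rightarrow> 'b) \<Rightarrow> bool" where
  "represents_iso sig A \<theta> B \<eta> g \<longleftrightarrow> (\<forall>a\<in>carrier A. g a \<in> carrier B) \<and>
    (\<forall>a\<in>carrier A. \<forall>a'\<in>carrier A. (a, a') \<in> \<theta> \<longleftrightarrow> (g a, g a') \<in> \<eta>) \<and>
    (\<forall>b\<in>carrier B. \<exists>a\<in>carrier A. (g a, b) \<in> \<eta>) \<and>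
    (\<forall>f<length sig. \<forall>xs. length xs = sig ! f \<longrightarrow> set xs \<subseteq> carrier A \<longrightarrow>
       (g (op A f xs), op B f (map g xs)) \<in> \<eta>)"

lemma represents_isoD:
  assumes "represents_iso sig A \<theta> B \<eta> g"
  shows "a \<in> carrier A \<Longrightarrow> g a \<in> carrier B"
    "a \<in> carrier A \<Longrightarrow> a' \<in> carrier A \<Longrightarrow> (a, a') \<in> \<theta> \<longleftrightarrow> (g a, g a') \<in> \<eta>"
    "b \<in> carrier B \<Longrightarrow> \<exists>a\<in>carrier A. (g a, b) \<in> \<eta>"
    "f < length sig \<Longrightarrow> length xs = sig ! f \<Longrightarrow> set xs \<subseteq> carrier A \<Longrightarrow>
       (g (op A f xs), op B f (map g xs)) \<in> \<eta>"
  using assms unfolding represents_iso_def by blast+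

lemma isomorphic_iff_represents:
  assumes \<theta>: "congruence sig A \<theta>" and \<eta>: "congruence sig B \<eta>"
  shows "isomorphic sig (quotient_algebra A \<theta>) (quotient_algebra B \<eta>) \<longleftrightarrow>
    (\<exists>g. represents_iso sig A \<theta> B \<eta> g)" (is "isomorphic sig ?A ?B \<longleftrightarrow> _")
proof
  assume "isomorphic sig ?A ?B"
  then obtain \<phi> where bij: "bij_betw \<phi> (carrier A // \<theta>) (carrier B // \<eta>)"
    and hom: "\<And>f xs. f < length sig \<Longrightarrow> length xs = sig ! f \<Longrightarrow> set xs \<subseteq> carrier A // \<theta> \<Longrightarrow>
       \<phi> (op ?A f xs) = op ?B f (map \<phi> xs)"
    unfolding isomorphic_def carrier_quotient by blast
  have "\<forall>a\<in>carrier A. \<exists>b. b \<in> carrier B \<and> \<phi> (\<theta> `` {a}) = \<eta> `` {b}"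
    using bij_betw_imp_surj_on[OF bij] by (metis imageI quotientE quotientI)
  then obtain g where g: "\<And>a. a \<in> carrier A \<Longrightarrow> g a \<in> carrier B"
    "\<And>a. a \<in> carrier A \<Longrightarrow> \<phi> (\<theta> `` {a}) = \<eta> `` {g a}" by metis
  have "represents_iso sig A \<theta> B \<eta> g"
    unfolding represents_iso_def
  proof (intro conjI ballI allI impI)
    show "g a \<in> carrier B" if "a \<in> carrier A" for a using that by (rule g(1))
    show "(a, a') \<in> \<theta> \<longleftrightarrow> (g a, g a') \<in> \<eta>" if a: "a \<in> carrier A" "a' \<in> carrier A" for a a'
    proof -
      have "(a, a') \<in> \<theta> \<longleftrightarrow> \<phi> (\<theta> `` {a}) = \<phi> (\<theta> `` {a'})"
        using class_eq_iff[OF \<theta> a] bij_betw_imp_inj_on[OF bij] a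
        by (metis inj_onD quotientI)
      then show ?thesis using g a class_eq_iff[OF \<eta>] by simp
    qed
    show "\<exists>a\<in>carrier A. (g a, b) \<in> \<eta>" if b: "b \<in> carrier B" for b
    proof -
      have "\<eta> `` {b} \<in> \<phi> ` (carrier A // \<theta>)"
        using bij_betw_imp_surj_on[OF bij] b by (simp add: quotientI)
      then obtain a where "a \<in> carrier A" "\<eta> `` {b} = \<phi> (\<theta> `` {a})" by (auto elim: quotientE)
      then show ?thesis using g class_eq_iff[OF \<eta> _ b] by metis
    qed
    show "(g (op A f xs), op B f (map g xs)) \<in> \<eta>"
      if f: "f < length sig" "length xs = sig ! f" "set xs \<subseteq> carrier A" for f xs
    proof -
      let ?Cs = "map (\<lambda>x. \<theta> `` {x}) xs"
      have opA: "op A f xs \<in> carrier A" using closedD[OF congruence_closed[OF \<theta>] f] .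
      have gxs: "set (map g xs) \<subseteq> carrier B" using f(3) g(1) by auto
      have "\<eta> `` {g (op A f xs)} = \<phi> (op ?A f ?Cs)" using op_quotient[OF \<theta> f] g(2)[OF opA] by simp
      also have "\<dots> = op ?B f (map \<phi> ?Cs)"
        using f by (intro hom) (auto intro: quotientI)
      also have "map \<phi> ?Cs = map (\<lambda>x. \<eta> `` {x}) (map g xs)" using f(3) g(2) by auto
      also have "op ?B f \<dots> = \<eta> `` {op B f (map g xs)}" using op_quotient[OF \<eta> _ _ gxs] f by simp
      finally show ?thesis
        using class_eq_iff[OF \<eta> g(1)[OF opA] closedD[OF congruence_closed[OF \<eta>] _ _ gxs]] f by simp
    qed
  qed
  then show "\<exists>g. represents_iso sig A \<theta> B \<eta> g" by blast
next
  assume "\<exists>g. represents_iso sig A \<theta> B \<eta> g"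
  then obtain g where "represents_iso sig A \<theta> B \<eta> g" by blast
  note g = represents_isoD[OF this]
  \<comment> \<open>Closing the image under \<open>\<eta>\<close> defines the map on classes without
    choosing representatives.\<close>
  define \<phi> where "\<phi> C = \<eta> `` (g ` C)" for C
  have \<phi>: "\<phi> (\<theta> `` {a}) = \<eta> `` {g a}" if a: "a \<in> carrier A" for a
  proof
    show "\<phi> (\<theta> `` {a}) \<subseteq> \<eta> `` {g a}"
      unfolding \<phi>_def using g(2)[OF a] congruenceD(2)[OF \<theta>] congruenceD(5)[OF \<eta>] by blast
    show "\<eta> `` {g a} \<subseteq> \<phi> (\<theta> `` {a})"
      unfolding \<phi>_def using congruenceD(3)[OF \<theta> a] by blast
  qed
  have "inj_on \<phi> (carrier A // \<theta>)"
  proof (rule inj_onI)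
    fix C D assume CD: "C \<in> carrier A // \<theta>" "D \<in> carrier A // \<theta>" and eq: "\<phi> C = \<phi> D"
    from CD obtain a b where ab: "C = \<theta> `` {a}" "D = \<theta> `` {b}" "a \<in> carrier A" "b \<in> carrier A"
      by (auto elim!: quotientE)
    then have "(g a, g b) \<in> \<eta>" using eq \<phi> class_eq_iff[OF \<eta> g(1) g(1)] by simp
    then show "C = D" using ab g(2) class_eq_iff[OF \<theta>] by simp
  qed
  moreover have "\<phi> ` (carrier A // \<theta>) = carrier B // \<eta>"
  proof
    show "\<phi> ` (carrier A // \<theta>) \<subseteq> carrier B // \<eta>"
      using \<phi> g(1) by (auto elim!: quotientE simp: quotientI)
    show "carrier B // \<eta> \<subseteq> \<phi> ` (carrier A // \<theta>)"
    proof
      fix D assume "D \<in> carrier B // \<eta>"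
      then obtain b where b: "D = \<eta> `` {b}" "b \<in> carrier B" by (auto elim: quotientE)
      then obtain a where a: "a \<in> carrier A" "(g a, b) \<in> \<eta>" using g(3) by blast
      then have "D = \<phi> (\<theta> `` {a})" using b class_eq_iff[OF \<eta> g(1)[OF a(1)] b(2)] \<phi> by simp
      then show "D \<in> \<phi> ` (carrier A // \<theta>)" using a(1) by (simp add: quotientI)
    qed
  qed
  moreover have "\<phi> (op ?A f Cs) = op ?B f (map \<phi> Cs)"
    if f: "f < length sig" "length Cs = sig ! f" "set Cs \<subseteq> carrier A // \<theta>" for f Cs
  proof -
    from quotient_lift[OF f(3)] obtain xs where
      xs: "Cs = map (\<lambda>x. \<theta> `` {x}) xs" "set xs \<subseteq> carrier A" by blast
    have len: "length xs = sig ! f" using f(2) xs(1) by simp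
    have opA: "op A f xs \<in> carrier A" using closedD[OF congruence_closed[OF \<theta>] f(1) len xs(2)] .
    have gxs: "set (map g xs) \<subseteq> carrier B" using xs(2) g(1) by auto
    have "map \<phi> Cs = map (\<lambda>x. \<eta> `` {x}) (map g xs)" using xs \<phi> by auto
    then have "op ?B f (map \<phi> Cs) = \<eta> `` {op B f (map g xs)}"
      using op_quotient[OF \<eta> f(1) _ gxs] len by simp
    also have "\<dots> = \<eta> `` {g (op A f xs)}"
      using class_eq_iff[OF \<eta> g(1)[OF opA] closedD[OF congruence_closed[OF \<eta>] f(1) _ gxs]]
        g(4)[OF f(1) len xs(2)] len by simp
    also have "\<dots> = \<phi> (op ?A f Cs)" using op_quotient[OF \<theta> f(1) len xs(2)] \<phi>[OF opA] xs(1) by simp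
    finally show ?thesis by simp
  qed
  ultimately show "isomorphic sig ?A ?B"
    unfolding isomorphic_def carrier_quotient bij_betw_def by blast
qed

text \<open>Finitely many choices made at once: representatives for all positions of two related
  argument lists.\<close>

lemma congruence_lift:
  "list_all2 (\<lambda>x y. \<exists>a b. P a b x y) xs ys \<Longrightarrow>
    \<exists>as bs. length as = length xs \<and> length bs = length xs \<and>
      (\<forall>i<length xs. P (as ! i) (bs ! i) (xs ! i) (ys ! i))"
proof (induction rule: list_all2_induct)
  case (Cons x xs y ys)
  then obtain a b as bs where "P a b x y" "length as = length xs" "length bs = length xs"
    "\<forall>i<length xs. P (as ! i) (bs ! i) (xs ! i) (ys ! i)" by blast
  then show ?case by (intro exI[of _ "a # as"] exI[of _ "b # bs"]) (simp add: nth_Cons split: nat.split)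
qed simp

text \<open>This is the correspondence theorem for congruences. It lets relations added to one
  presentation be copied to an isomorphic algebra presented on other generators.\<close>

lemma isomorphic_transport:
  assumes \<theta>: "congruence sig A \<theta>" and \<eta>: "congruence sig B \<eta>" and \<theta>': "congruence sig A \<theta>'"
    and sub: "\<theta> \<subseteq> \<theta>'" and iso: "isomorphic sig (quotient_algebra A \<theta>) (quotient_algebra B \<eta>)"
  obtains \<eta>' where "congruence sig B \<eta>'" "\<eta> \<subseteq> \<eta>'"
    "isomorphic sig (quotient_algebra A \<theta>') (quotient_algebra B \<eta>')"
proof -
  from iso obtain g where "represents_iso sig A \<theta> B \<eta> g"
    unfolding isomorphic_iff_represents[OF \<theta> \<eta>] by blast
  note g = represents_isoD[OF this]
  \<comment> \<open>The image of \<open>\<theta>'\<close> under \<open>g\<close>, saturated by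
    \<open>\<eta>\<close> because \<open>g\<close> is surjective only modulo
    \<open>\<eta>\<close>.\<close>
  define \<eta>' where "\<eta>' = {(b, b'). \<exists>a a'. (a, a') \<in> \<theta>' \<and> (g a, b) \<in> \<eta> \<and> (g a', b') \<in> \<eta>}"
  have sub': "\<eta> \<subseteq> \<eta>'"
  proof (clarify)
    fix b b' assume b: "(b, b') \<in> \<eta>"
    then obtain a where "a \<in> carrier A" "(g a, b) \<in> \<eta>" using g(3) congruenceD(1)[OF \<eta>] by blast
    then show "(b, b') \<in> \<eta>'"
      unfolding \<eta>'_def using b congruenceD(3)[OF \<theta>'] congruenceD(5)[OF \<eta>] by blast
  qed
  have ker: "(a, a') \<in> \<theta>' \<longleftrightarrow> (g a, g a') \<in> \<eta>'" if a: "a \<in> carrier A" "a' \<in> carrier A" for a a'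
  proof
    assume "(g a, g a') \<in> \<eta>'"
    then obtain x x' where x: "(x, x') \<in> \<theta>'" "(g x, g a) \<in> \<eta>" "(g x', g a') \<in> \<eta>"
      unfolding \<eta>'_def by blast
    then have "(x, a) \<in> \<theta>'" "(x', a') \<in> \<theta>'"
      using g(2) a congruenceD(1,2)[OF \<theta>'] sub by blast+
    then show "(a, a') \<in> \<theta>'" using x(1) congruenceD(4,5)[OF \<theta>'] by meson
  next
    assume "(a, a') \<in> \<theta>'"
    then show "(g a, g a') \<in> \<eta>'" unfolding \<eta>'_def using a g(1) congruenceD(3)[OF \<eta>] by blast
  qed
  have \<eta>': "congruence sig B \<eta>'"
  proof (rule congruenceI)
    show "b \<in> carrier B \<and> b' \<in> carrier B" if "(b, b') \<in> \<eta>'" for b b'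
      using that congruenceD(2)[OF \<eta>] unfolding \<eta>'_def by blast
    show "(b, b) \<in> \<eta>'" if "b \<in> carrier B" for b using that congruenceD(3)[OF \<eta>] sub' by blast
    show "(b', b) \<in> \<eta>'" if "(b, b') \<in> \<eta>'" for b b'
      using that congruenceD(4)[OF \<theta>'] unfolding \<eta>'_def by blast
    show "(b, d) \<in> \<eta>'" if b: "(b, c) \<in> \<eta>'" "(c, d) \<in> \<eta>'" for b c d
    proof -
      from b obtain w x y z where *: "(w, x) \<in> \<theta>'" "(g w, b) \<in> \<eta>" "(g x, c) \<in> \<eta>"
        "(y, z) \<in> \<theta>'" "(g y, c) \<in> \<eta>" "(g z, d) \<in> \<eta>" unfolding \<eta>'_def by blast
      \<comment> \<open>Both \<open>x\<close> and \<open>y\<close> represent the class of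
        \<open>c\<close>. As \<open>g\<close> reflects \<open>\<eta>\<close> to
        \<open>\<theta>\<close>, the inclusion of \<open>\<theta>\<close> in
        \<open>\<theta>'\<close> links the two pairs.\<close>
      then have "(g x, g y) \<in> \<eta>" using congruenceD(4,5)[OF \<eta>] by meson
      then have "(x, y) \<in> \<theta>'" using g(2) congruenceD(1,2)[OF \<theta>'] * sub by blast
      then have "(w, z) \<in> \<theta>'" using congruenceD(5)[OF \<theta>'] * by meson
      with * show ?thesis unfolding \<eta>'_def by blast
    qed
    show "(op B f xs, op B f ys) \<in> \<eta>'"
      if f: "f < length sig" "length xs = sig ! f" and xy: "list_all2 (\<lambda>x y. (x, y) \<in> \<eta>') xs ys" for f xs ys
    proof -
      from xy have "list_all2 (\<lambda>x y. \<exists>a a'. (a, a') \<in> \<theta>' \<and> (g a, x) \<in> \<eta> \<and> (g a', y) \<in> \<eta>) xs ys"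
        unfolding \<eta>'_def by simp
      from congruence_lift[OF this] obtain as bs where
        len: "length as = length xs" "length bs = length xs" and
        ab: "\<forall>i<length xs. (as ! i, bs ! i) \<in> \<theta>' \<and> (g (as ! i), xs ! i) \<in> \<eta> \<and> (g (bs ! i), ys ! i) \<in> \<eta>"
        by blast
      have len_ys: "length ys = length xs" using xy by (simp add: list_all2_lengthD)
      have as: "set as \<subseteq> carrier A" and bs: "set bs \<subseteq> carrier A"
        using ab len congruenceD(1,2)[OF \<theta>'] by (metis in_set_conv_nth subsetI)+
      have "(op A f as, op A f bs) \<in> \<theta>'"
        using f len ab by (intro congruenceD(6)[OF \<theta>']) (auto simp: list_all2_conv_all_nth)
      moreover have "(op B f (map g as), op B f xs) \<in> \<eta>" "(op B f (map g bs), op B f ys) \<in> \<eta>"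
        using f len ab len_ys by (auto intro!: congruenceD(6)[OF \<eta>] simp: list_all2_conv_all_nth)
      moreover have "(g (op A f as), op B f (map g as)) \<in> \<eta>" "(g (op A f bs), op B f (map g bs)) \<in> \<eta>"
        using g(4) f len as bs by simp_all
      ultimately show ?thesis unfolding \<eta>'_def using congruenceD(5)[OF \<eta>] by blast
    qed
  qed
  have "represents_iso sig A \<theta>' B \<eta>' g"
    unfolding represents_iso_def using g(1,3,4) ker sub' by blast
  then show ?thesis using that \<eta>' sub' isomorphic_iff_represents[OF \<theta>' \<eta>'] by blast
qed

section \<open>Preimages, ascending chains and the Hopf property\<close>

lemma congruence_preimage:
  assumes A: "closed sig A" and \<eta>: "congruence sig B \<eta>" and g: "\<forall>a\<in>carrier A. g a \<in> carrier B"
    and hom: "\<And>f xs. f < length sig \<Longrightarrow> length xs = sig ! f \<Longrightarrow> set xs \<subseteq> carrier A \<Longrightarrow>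
       (g (op A f xs), op B f (map g xs)) \<in> \<eta>"
  shows "congruence sig A {(a, b) \<in> carrier A \<times> carrier A. (g a, g b) \<in> \<eta>}"
proof (rule congruenceI, goal_cases)
  case (2 a) then show ?case using congruenceD(3)[OF \<eta>] g by auto
next
  case (3 a b) then show ?case using congruenceD(4)[OF \<eta>] by auto
next
  case (4 a b c) then show ?case using congruenceD(5)[OF \<eta>] by blast
next
  case (5 f xs ys)
  have len: "length ys = length xs" using 5(3) by (simp add: list_all2_lengthD)
  have xs: "set xs \<subseteq> carrier A" "set ys \<subseteq> carrier A"
    using 5(3) len unfolding list_all2_conv_all_nth by (auto simp: in_set_conv_nth)
  have "(op B f (map g xs), op B f (map g ys)) \<in> \<eta>"
    using 5 by (intro congruenceD(6)[OF \<eta>]) (auto simp: list_all2_conv_all_nth)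
  moreover have "(g (op A f xs), op B f (map g xs)) \<in> \<eta>" "(g (op A f ys), op B f (map g ys)) \<in> \<eta>"
    using hom 5 xs len by simp_all
  ultimately have "(g (op A f xs), g (op A f ys)) \<in> \<eta>"
    using congruenceD(4,5)[OF \<eta>] by meson
  then show ?case using closedD[OF A] 5 xs len by simp
qed auto

text \<open>The chain is pushed down to the quotient, where the chain condition is assumed. Nothing
  is lost: each \<open>\<theta> n\<close> contains \<open>\<Phi>\<close>, so membership of a pair of
  classes does not depend on the representatives.\<close>

lemma ACC_above:
  assumes \<Phi>: "congruence sig A \<Phi>" and acc: "ACC sig (quotient_algebra A \<Phi>)"
    and \<theta>: "\<And>n :: nat. congruence sig A (\<theta> n)" "\<And>n. \<Phi> \<subseteq> \<theta> n" "\<And>n. \<theta> n \<subseteq> \<theta> (Suc n)"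
  shows "\<exists>N. \<forall>n\<ge>N. \<theta> n = \<theta> N"
proof -
  define \<theta>' where "\<theta>' n = {(\<Phi> `` {x}, \<Phi> `` {y}) | x y. (x, y) \<in> \<theta> n}" for n
  have iff: "(\<Phi> `` {x}, \<Phi> `` {y}) \<in> \<theta>' n \<longleftrightarrow> (x, y) \<in> \<theta> n" if xy: "x \<in> carrier A" "y \<in> carrier A" for n x y
  proof
    assume "(\<Phi> `` {x}, \<Phi> `` {y}) \<in> \<theta>' n"
    then obtain u v where uv: "\<Phi> `` {x} = \<Phi> `` {u}" "\<Phi> `` {y} = \<Phi> `` {v}" "(u, v) \<in> \<theta> n"
      unfolding \<theta>'_def by blast
    then have "(x, u) \<in> \<Phi>" "(v, y) \<in> \<Phi>"
      using class_eq_iff[OF \<Phi>] xy congruenceD(1,2)[OF \<theta>(1) uv(3)] by metis+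
    then show "(x, y) \<in> \<theta> n" using uv(3) \<theta>(2) congruenceD(5)[OF \<theta>(1)] by (meson subsetD)
  qed (auto simp: \<theta>'_def)
  have "congruence sig (quotient_algebra A \<Phi>) (\<theta>' n)" for n
  proof (rule congruenceI, unfold carrier_quotient, goal_cases)
    case (1 C D) then show ?case
      using congruenceD(1,2)[OF \<theta>(1)] unfolding \<theta>'_def by (auto intro: quotientI)
  next
    case (2 C) then show ?case
      using congruenceD(3)[OF \<theta>(1)] unfolding \<theta>'_def by (auto elim!: quotientE)
  next
    case (3 C D) then show ?case using congruenceD(4)[OF \<theta>(1)] unfolding \<theta>'_def by blast
  next
    case (4 B C D)
    then obtain u v w z where *: "B = \<Phi> `` {u}" "C = \<Phi> `` {v}" "(u, v) \<in> \<theta> n"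
      "C = \<Phi> `` {w}" "D = \<Phi> `` {z}" "(w, z) \<in> \<theta> n" unfolding \<theta>'_def by blast
    then have "(v, z) \<in> \<theta> n" using 4(2) iff congruenceD(1,2)[OF \<theta>(1)] by metis
    then have "(u, z) \<in> \<theta> n" using * congruenceD(5)[OF \<theta>(1)] by blast
    then show ?case using * unfolding \<theta>'_def by blast
  next
    case (5 f Cs Ds)
    from 5(3) have "list_all2 (\<lambda>C D. \<exists>x y. (x, y) \<in> \<theta> n \<and> C = \<Phi> `` {x} \<and> D = \<Phi> `` {y}) Cs Ds"
      unfolding \<theta>'_def by (auto elim!: list_all2_mono)
    from congruence_lift[OF this] obtain xs ys where
      len: "length xs = length Cs" "length ys = length Cs" and
      xy: "\<forall>i<length Cs. (xs ! i, ys ! i) \<in> \<theta> n \<and> Cs ! i = \<Phi> `` {xs ! i} \<and> Ds ! i = \<Phi> `` {ys ! i}"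
      by blast
    have xs: "set xs \<subseteq> carrier A" and ys: "set ys \<subseteq> carrier A"
      using xy len congruenceD(1,2)[OF \<theta>(1)] by (metis in_set_conv_nth subsetI)+
    have "length Ds = length Cs" using 5(3) by (simp add: list_all2_lengthD)
    then have Cs: "Cs = map (\<lambda>x. \<Phi> `` {x}) xs" and Ds: "Ds = map (\<lambda>x. \<Phi> `` {x}) ys"
      unfolding list_eq_iff_nth_eq using xy len by simp_all
    have lx: "length xs = sig ! f" and ly: "length ys = sig ! f" using 5(2) len by simp_all
    have "(op A f xs, op A f ys) \<in> \<theta> n"
      using xy len lx 5(1) by (intro congruenceD(6)[OF \<theta>(1)]) (simp_all add: list_all2_conv_all_nth)
    then have "(\<Phi> `` {op A f xs}, \<Phi> `` {op A f ys}) \<in> \<theta>' n" unfolding \<theta>'_def by blast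
    then show ?case
      unfolding Cs Ds op_quotient[OF \<Phi> 5(1) lx xs] op_quotient[OF \<Phi> 5(1) ly ys] .
  qed
  moreover have "\<theta>' n \<subseteq> \<theta>' (Suc n)" for n using \<theta>(3) unfolding \<theta>'_def by blast
  ultimately obtain N where N: "\<forall>n\<ge>N. \<theta>' n = \<theta>' N" using acc unfolding ACC_def by blast
  have "\<theta> n = \<theta> N" if "n \<ge> N" for n
  proof -
    have "(x, y) \<in> \<theta> n \<longleftrightarrow> (x, y) \<in> \<theta> N" for x y
      using iff N that congruenceD(1,2)[OF \<theta>(1)] by metis
    then show ?thesis by auto
  qed
  then show ?thesis by blast
qed

text \<open>The kernels of the powers of a surjective endomorphism form an ascending chain.\<close>

lemma ACC_hopfian:
  assumes \<Phi>: "congruence sig A \<Phi>" and acc: "ACC sig (quotient_algebra A \<Phi>)"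
    and \<eta>: "congruence sig A \<eta>" "\<Phi> \<subseteq> \<eta>"
    and iso: "isomorphic sig (quotient_algebra A \<eta>) (quotient_algebra A \<Phi>)"
  shows "\<eta> = \<Phi>"
proof -
  from iso obtain g where "represents_iso sig A \<eta> A \<Phi> g"
    unfolding isomorphic_iff_represents[OF \<eta>(1) \<Phi>] by blast
  note g = represents_isoD[OF this]
  \<comment> \<open>Preceded by the projection from the quotient by \<open>\<Phi>\<close> to that by
    \<open>\<eta>\<close>, \<open>g\<close> induces a surjective endomorphism of the former.
    \<open>\<theta> n\<close> is the kernel of its \<open>n\<close>-th power, pulled back to
    \<open>A\<close>.\<close>
  define pre where "pre \<theta> = {(a, b) \<in> carrier A \<times> carrier A. (g a, g b) \<in> \<theta>}" for \<theta>
  define \<theta> where "\<theta> n = (pre ^^ n) \<Phi>" for n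
  have \<theta>_Suc: "\<theta> (Suc n) = pre (\<theta> n)" for n by (simp add: \<theta>_def)
  have \<theta>_0: "\<theta> 0 = \<Phi>" by (simp add: \<theta>_def)
  have \<theta>_1: "\<theta> (Suc 0) = \<eta>"
  proof -
    have "(a, b) \<in> pre \<Phi> \<longleftrightarrow> (a, b) \<in> \<eta>" for a b
      unfolding pre_def using g(2)[of a b] congruenceD(1,2)[OF \<eta>(1), of a b] by blast
    then show ?thesis unfolding \<theta>_Suc \<theta>_0 by auto
  qed
  have mono: "\<theta> n \<subseteq> \<theta> (Suc n)" for n
  proof (induction n)
    case 0
    show ?case using \<eta>(2) \<theta>_0 \<theta>_1 by simp
  next
    case (Suc n)
    then show ?case unfolding \<theta>_Suc[of "Suc n"] \<theta>_Suc[of n] pre_def by blast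
  qed
  have above: "\<Phi> \<subseteq> \<theta> n" for n
    by (induction n) (use mono \<theta>_0 in auto)
  have cong: "congruence sig A (\<theta> n)" for n
  proof (induction n)
    case 0
    show ?case using \<Phi> \<theta>_0 by simp
  next
    case (Suc n)
    show ?case unfolding \<theta>_Suc pre_def
      by (rule congruence_preimage[OF congruence_closed[OF \<Phi>] Suc]) (use g(1,4) above in blast)+
  qed
  from ACC_above[OF \<Phi> acc, of \<theta>, OF cong above mono] obtain N where "\<theta> (Suc N) = \<theta> N"
    using le_Suc_eq by blast
  \<comment> \<open>Equality of consecutive stages descends by one: as \<open>g\<close> is
    surjective modulo \<open>\<Phi>\<close>, a pair can be pulled back along \<open>g\<close>,
    compared one stage later, and mapped forward again.\<close>
  then have "\<theta> (Suc 0) = \<theta> 0"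
  proof (induction N)
    case (Suc N)
    have "(s, t) \<in> \<theta> N" if st: "(s, t) \<in> \<theta> (Suc N)" for s t
    proof -
      obtain s' t' where s': "s' \<in> carrier A" "(g s', s) \<in> \<Phi>" and t': "t' \<in> carrier A" "(g t', t) \<in> \<Phi>"
        using g(3) congruenceD(1,2)[OF cong st] by meson
      have lift: "(g s', g t') \<in> \<theta> n" if "(s, t) \<in> \<theta> n" for n
        using that s'(2) t'(2) above congruenceD(4,5)[OF cong] by (meson subsetD)
      have "(s', t') \<in> \<theta> (Suc (Suc N))" using lift[OF st] s' t' by (simp add: \<theta>_Suc[of "Suc N"] pre_def)
      then have "(g s', g t') \<in> \<theta> N" using Suc.prems by (simp add: \<theta>_Suc[of N] pre_def)
      then show ?thesis using s'(2) t'(2) above congruenceD(4,5)[OF cong] by (meson subsetD)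
    qed
    then have "\<theta> (Suc N) = \<theta> N" using mono[of N] by auto
    then show ?case by (rule Suc.IH)
  qed simp
  then show ?thesis using \<theta>_0 \<theta>_1 by simp
qed

section \<open>Generated congruences\<close>

lemma generated_congruence_least:
  "congruence sig A \<theta> \<Longrightarrow> S \<subseteq> \<theta> \<Longrightarrow> generated_congruence sig A S \<subseteq> \<theta>"
  unfolding generated_congruence_def by blast

lemma generated_congruence_superset: "S \<subseteq> generated_congruence sig A S"
  unfolding generated_congruence_def by blast

lemma congruence_generated:
  assumes A: "closed sig A" and S: "S \<subseteq> carrier A \<times> carrier A"
  shows "congruence sig A (generated_congruence sig A S)"
proof -
  have full: "congruence sig A (carrier A \<times> carrier A)"
    by (rule congruenceI) (auto intro!: closedD[OF A] dest: list_all2_lengthD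
        simp: list_all2_conv_all_nth in_set_conv_nth)
  show ?thesis
  proof (rule congruenceI, goal_cases)
    case (1 a b) then show ?case
      using generated_congruence_least[OF full S] by blast
  next
    case (2 a) then show ?case
      unfolding generated_congruence_def by (blast intro: congruenceD(3))
  next
    case (3 a b) then show ?case
      unfolding generated_congruence_def by (blast intro: congruenceD(4))
  next
    case (4 a b c) then show ?case
      unfolding generated_congruence_def by (blast intro: congruenceD(5))
  next
    case (5 f xs ys)
    show ?case unfolding generated_congruence_def
    proof clarify
      fix \<theta> assume \<theta>: "congruence sig A \<theta>" "S \<subseteq> \<theta>"
      from 5(3) have "list_all2 (\<lambda>x y. (x, y) \<in> \<theta>) xs ys"
        using generated_congruence_least[OF \<theta>] by (auto elim!: list_all2_mono)
      then show "(op A f xs, op A f ys) \<in> \<theta>" using congruenceD(6)[OF \<theta>(1)] 5 by blast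
    qed
  qed
qed

text \<open>If no finite part of \<open>R\<close> sufficed, adding again and again a pair of
  \<open>R\<close> not yet implied would give a strictly ascending chain. The set \<open>L\<close>,
  later the law instances, belongs to every stage, so the chain lies above the congruence generated
  by \<open>L\<close>, where the chain condition is available.\<close>

lemma ACC_finitely_generated:
  assumes A: "closed sig A" and L: "L \<subseteq> carrier A \<times> carrier A" and R: "R \<subseteq> carrier A \<times> carrier A"
    and acc: "ACC sig (quotient_algebra A (generated_congruence sig A L))"
  shows "\<exists>S. finite S \<and> S \<subseteq> R \<and> generated_congruence sig A (S \<union> L) = generated_congruence sig A (R \<union> L)"
proof (rule ccontr)
  let ?g = "\<lambda>S. generated_congruence sig A (S \<union> L)"
  have cong: "congruence sig A (?g S)" if "S \<subseteq> R" for S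
    using that R L by (intro congruence_generated[OF A]) blast
  assume neg: "\<not> ?thesis"
  have ex: "\<exists>p. p \<in> R - ?g S" if S: "finite S" "S \<subseteq> R" for S
  proof (rule ccontr)
    assume "\<not> (\<exists>p. p \<in> R - ?g S)"
    then have "?g R \<subseteq> ?g S"
      using generated_congruence_superset[of "S \<union> L" sig A]
      by (intro generated_congruence_least cong S) blast
    moreover have "?g S \<subseteq> ?g R"
      using S generated_congruence_superset[of "R \<union> L" sig A]
      by (intro generated_congruence_least cong) blast+
    ultimately show False using neg S by blast
  qed
  define pick where "pick S = (SOME p. p \<in> R - ?g S)" for S
  have pick: "pick S \<in> R - ?g S" if "finite S" "S \<subseteq> R" for S
    unfolding pick_def using someI_ex[OF ex[OF that]] .
  define s where "s n = ((\<lambda>S. insert (pick S) S) ^^ n) {}" for n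
  have s_Suc: "s (Suc n) = insert (pick (s n)) (s n)" for n by (simp add: s_def)
  have s: "finite (s n) \<and> s n \<subseteq> R" for n
  proof (induction n)
    case (Suc n) then show ?case using pick[of "s n"] by (auto simp: s_Suc)
  qed (simp add: s_def)
  have "\<exists>N. \<forall>n\<ge>N. ?g (s n) = ?g (s N)"
  proof (rule ACC_above[OF congruence_generated[OF A L] acc])
    show "congruence sig A (?g (s n))" for n using cong s by blast
    then show "generated_congruence sig A L \<subseteq> ?g (s n)" for n
      using generated_congruence_superset[of "s n \<union> L" sig A]
      by (intro generated_congruence_least) auto
    show "?g (s n) \<subseteq> ?g (s (Suc n))" for n
      using generated_congruence_superset[of "s (Suc n) \<union> L" sig A] s s_Suc
      by (intro generated_congruence_least cong) blast+
  qed
  then obtain N where "?g (s (Suc N)) = ?g (s N)" using le_Suc_eq by blast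
  moreover have "pick (s N) \<in> ?g (s (Suc N))"
    using generated_congruence_superset[of "s (Suc N) \<union> L" sig A] s_Suc by auto
  ultimately show False using pick[of "s N"] s by blast
qed

section \<open>Term algebras and presentations\<close>

abbreviation term_alg :: "signature \<Rightarrow> nat \<Rightarrow> trm algebra" where
  "term_alg sig k \<equiv> term_algebra sig {..<k}"

lemma carrier_term_algebra [simp]: "carrier (term_algebra sig X) = terms sig X"
  and op_term_algebra [simp]: "op (term_algebra sig X) = Fn"
  by (simp_all add: term_algebra_def)

lemma closed_term_algebra: "closed sig (term_algebra sig X)"
  unfolding closed_def by (auto intro: terms.intros)

lemma subst_terms:
  "t \<in> terms sig X \<Longrightarrow> (\<And>i. i \<in> X \<Longrightarrow> \<sigma> i \<in> terms sig Y) \<Longrightarrow> subst \<sigma> t \<in> terms sig Y"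
  by (induction rule: terms.induct) (auto intro!: terms.intros(2))

lemma terms_mono: "t \<in> terms sig X \<Longrightarrow> X \<subseteq> Y \<Longrightarrow> t \<in> terms sig Y"
  by (induction rule: terms.induct) (auto intro: terms.intros)

lemma subst_subst: "subst \<tau> (subst \<sigma> t) = subst (\<lambda>i. subst \<tau> (\<sigma> i)) t"
  by (induction t) simp_all

lemma subst_id: "t \<in> terms sig X \<Longrightarrow> (\<And>i. i \<in> X \<Longrightarrow> \<sigma> i = Var i) \<Longrightarrow> subst \<sigma> t = t"
  by (induction rule: terms.induct) (auto simp: map_idI)

lemma law_instances_terms:
  assumes "variety sig L"
  shows "law_instances sig L X \<subseteq> terms sig X \<times> terms sig X"
proof -
  have "subst \<sigma> t \<in> terms sig X" if "t \<in> terms sig UNIV" "range \<sigma> \<subseteq> terms sig X" for \<sigma> t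
    using that by (intro subst_terms[of t sig UNIV]) auto
  then show ?thesis using assms unfolding law_instances_def variety_def by blast
qed

locale fg_variety =
  fixes sig :: signature and L :: "(trm \<times> trm) set"
  assumes variety: "variety sig L"
begin

abbreviation quot :: "nat \<Rightarrow> trm rel \<Rightarrow> trm set algebra" where
  "quot k \<theta> \<equiv> quotient_algebra (term_alg sig k) \<theta>"

text \<open>The congruences whose quotients satisfy the laws; these quotients are the
  \<open>k\<close>-generated algebras of the variety.\<close>

definition lawful :: "nat \<Rightarrow> trm rel \<Rightarrow> bool" where
  "lawful k \<theta> \<longleftrightarrow> congruence sig (term_alg sig k) \<theta> \<and> law_instances sig L {..<k} \<subseteq> \<theta>"

definition pcong :: "nat \<Rightarrow> trm rel \<Rightarrow> trm rel" where
  "pcong k R = generated_congruence sig (term_alg sig k) (R \<union> law_instances sig L {..<k})"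

lemma presented_quot: "presented sig L k R = quot k (pcong k R)"
  by (simp add: presented_def pcong_def Let_def)

lemma lawful_congruence: "lawful k \<theta> \<Longrightarrow> congruence sig (term_alg sig k) \<theta>"
  by (simp add: lawful_def)

lemma pcong_superset: "R \<subseteq> pcong k R"
  unfolding pcong_def using generated_congruence_superset[of "R \<union> law_instances sig L {..<k}"] by blast

lemma lawful_pcong:
  assumes "R \<subseteq> pairs sig k"
  shows "lawful k (pcong k R)"
  unfolding lawful_def pcong_def
proof
  show "congruence sig (term_alg sig k)
      (generated_congruence sig (term_alg sig k) (R \<union> law_instances sig L {..<k}))"
    using assms law_instances_terms[OF variety, of "{..<k}"]
    by (intro congruence_generated closed_term_algebra) (simp add: pairs_def)
qed (use generated_congruence_superset[of "R \<union> law_instances sig L {..<k}"] in blast)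

lemma pcong_least: "lawful k \<theta> \<Longrightarrow> R \<subseteq> \<theta> \<Longrightarrow> pcong k R \<subseteq> \<theta>"
  unfolding pcong_def lawful_def by (intro generated_congruence_least) auto

lemma pcong_mono: "S \<subseteq> pairs sig k \<Longrightarrow> R \<subseteq> S \<Longrightarrow> pcong k R \<subseteq> pcong k S"
  using pcong_superset[of S k] by (intro pcong_least lawful_pcong) blast+

lemma pcong_lawful: "lawful k \<theta> \<Longrightarrow> pcong k \<theta> = \<theta>"
  by (intro equalityI pcong_least pcong_superset order_refl)

lemma lawful_pairs: 
  assumes "lawful k \<theta>" 
  shows "\<theta> \<subseteq> pairs sig k"
proof
  fix p assume "p \<in> \<theta>"
  then show "p \<in> pairs sig k"
    using congruenceD(1,2)[OF lawful_congruence[OF assms], of "fst p" "snd p"]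
    by (cases p) (simp add: pairs_def)
qed

lemma quot_sym: "lawful k \<theta> \<Longrightarrow> isomorphic sig (quot k \<theta>) B \<Longrightarrow> isomorphic sig B (quot k \<theta>)"
  by (rule isomorphic_sym[OF closed_quotient[OF lawful_congruence]])

text \<open>A substitution turns law instances into law instances, since substitutions compose; so
  pulling back along a substitution keeps the laws.\<close>

lemma lawful_preimage:
  assumes \<theta>: "lawful m \<theta>" and \<sigma>: "\<And>i. i < n \<Longrightarrow> \<sigma> i \<in> terms sig {..<m}"
  shows "lawful n {(s, t) \<in> terms sig {..<n} \<times> terms sig {..<n}. (subst \<sigma> s, subst \<sigma> t) \<in> \<theta>}"
proof -
  have sub: "subst \<sigma> t \<in> terms sig {..<m}" if "t \<in> terms sig {..<n}" for t
    using subst_terms[OF that] \<sigma> by simp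
  have "congruence sig (term_alg sig n)
    {(s, t) \<in> carrier (term_alg sig n) \<times> carrier (term_alg sig n). (subst \<sigma> s, subst \<sigma> t) \<in> \<theta>}"
  proof (rule congruence_preimage[OF closed_term_algebra lawful_congruence[OF \<theta>]])
    fix f xs assume *: "f < length sig" "length xs = sig ! f" "set xs \<subseteq> carrier (term_alg sig n)"
    then have "Fn f (map (subst \<sigma>) xs) \<in> terms sig {..<m}"
      using sub by (intro terms.intros(2)) auto
    then show "(subst \<sigma> (op (term_alg sig n) f xs), op (term_alg sig m) f (map (subst \<sigma>) xs)) \<in> \<theta>"
      using congruenceD(3)[OF lawful_congruence[OF \<theta>]] by simp
  qed (use sub in simp)
  moreover have "(subst \<sigma> s, subst \<sigma> t) \<in> \<theta>" if "(s, t) \<in> law_instances sig L {..<n}" for s t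
  proof -
    from that obtain \<tau> u v where st: "s = subst \<tau> u" "t = subst \<tau> v"
      "(u, v) \<in> L" "range \<tau> \<subseteq> terms sig {..<n}" unfolding law_instances_def by blast
    have "range (\<lambda>i. subst \<sigma> (\<tau> i)) \<subseteq> terms sig {..<m}" using st(4) sub by blast
    then have "(subst \<sigma> s, subst \<sigma> t) \<in> law_instances sig L {..<m}"
      unfolding st(1,2) subst_subst law_instances_def using st(3) by blast
    then show ?thesis using \<theta> unfolding lawful_def by blast
  qed
  ultimately show ?thesis
    using law_instances_terms[OF variety, of "{..<n}"] unfolding lawful_def by auto
qed

text \<open>The new generator is sent to the first one.\<close>

lemma extra_generator:
  assumes \<theta>: "lawful k \<theta>" and k: "k \<ge> 1"
  obtains \<eta> where "lawful (Suc k) \<eta>" "isomorphic sig (quot (Suc k) \<eta>) (quot k \<theta>)" "(Var 0, Var k) \<in> \<eta>"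
proof -
  define \<tau> where "\<tau> i = Var (if i < k then i else 0)" for i
  define \<eta> where "\<eta> = {(s, t) \<in> terms sig {..<Suc k} \<times> terms sig {..<Suc k}. (subst \<tau> s, subst \<tau> t) \<in> \<theta>}"
  have \<tau>: "\<tau> i \<in> terms sig {..<k}" for i
    using k by (auto simp: \<tau>_def intro: terms.intros)
  have \<eta>: "lawful (Suc k) \<eta>" unfolding \<eta>_def by (rule lawful_preimage[OF \<theta> \<tau>])
  have sub: "subst \<tau> t \<in> terms sig {..<k}" if "t \<in> terms sig {..<Suc k}" for t
    using subst_terms[OF that] \<tau> by simp
  note refl = congruenceD(3)[OF lawful_congruence[OF \<theta>]]
  have "represents_iso sig (term_alg sig (Suc k)) \<eta> (term_alg sig k) \<theta> (subst \<tau>)"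
    unfolding represents_iso_def
  proof (intro conjI ballI allI impI)
    fix t assume t: "t \<in> carrier (term_alg sig k)"
    then have "subst \<tau> t = t" "t \<in> terms sig {..<Suc k}"
      using subst_id[of t sig "{..<k}" \<tau>] terms_mono[of t sig "{..<k}" "{..<Suc k}"]
      by (auto simp: \<tau>_def)
    then show "\<exists>a\<in>carrier (term_alg sig (Suc k)). (subst \<tau> a, t) \<in> \<theta>"
      using refl[OF t] by (intro bexI[of _ t]) simp_all
  next
    fix f xs assume *: "f < length sig" "length xs = sig ! f" "set xs \<subseteq> carrier (term_alg sig (Suc k))"
    then have "Fn f (map (subst \<tau>) xs) \<in> terms sig {..<k}"
      using sub by (intro terms.intros(2)) auto
    then show "(subst \<tau> (op (term_alg sig (Suc k)) f xs), op (term_alg sig k) f (map (subst \<tau>) xs)) \<in> \<theta>"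
      using refl by simp
  qed (simp_all add: sub \<eta>_def)
  then have "isomorphic sig (quot (Suc k) \<eta>) (quot k \<theta>)"
    using isomorphic_iff_represents[OF lawful_congruence[OF \<eta>] lawful_congruence[OF \<theta>]] by blast
  moreover have "Var 0 \<in> terms sig {..<k}" using k by (intro terms.intros(1)) simp
  \<comment> \<open>Two distinct variables are identified. This pair will distinguish
    \<open>\<eta>\<close> from the free congruence in a nontrivial variety.\<close>
  then have "(Var 0, Var k) \<in> \<eta>"
    using refl[of "Var 0"] k by (simp add: \<eta>_def \<tau>_def terms.intros(1))
  ultimately show ?thesis using that \<eta> by blast
qed

text \<open>An equation between two distinct variables in a free algebra holds in the whole variety.
  It leaves only one-element algebras, since at least one generator is present, and these are all
  isomorphic.\<close>

lemma trivial_variety: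
  assumes free: "(Var 0, Var k) \<in> pcong n {}" and k: "0 < k"
    and \<theta>: "lawful m \<theta>" "lawful m' \<theta>'" and m: "m \<ge> 1" "m' \<ge> 1"
  shows "isomorphic sig (quot m \<theta>) (quot m' \<theta>')"
proof -
  have all: "(s, t) \<in> \<theta>"
    if \<theta>: "lawful m \<theta>" and st: "s \<in> terms sig {..<m}" "t \<in> terms sig {..<m}" for m s t \<theta>
  proof -
    \<comment> \<open>\<open>Var 0\<close> goes to \<open>s\<close>, and \<open>Var k\<close> goes
      to \<open>t\<close> because \<open>k\<close> is positive.\<close>
    let ?\<sigma> = "\<lambda>i. if i = 0 then s else t"
    have "pcong n {} \<subseteq> {(a, b) \<in> terms sig {..<n} \<times> terms sig {..<n}. (subst ?\<sigma> a, subst ?\<sigma> b) \<in> \<theta>}"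
      using st by (intro pcong_least lawful_preimage[OF \<theta>]) simp_all
    then show ?thesis using free k by auto
  qed
  have var: "Var 0 \<in> terms sig {..<m}" if "m \<ge> 1" for m using that by (auto intro: terms.intros)
  have "represents_iso sig (term_alg sig m) \<theta> (term_alg sig m') \<theta>' (\<lambda>_. Var 0)"
    unfolding represents_iso_def
  proof (intro conjI ballI allI impI)
    fix b assume "b \<in> carrier (term_alg sig m')"
    then show "\<exists>a\<in>carrier (term_alg sig m). (Var 0, b) \<in> \<theta>'"
      using var[OF m(1)] all[OF \<theta>(2) var[OF m(2)]] by auto
  next
    fix f and xs :: "trm list" assume "f < length sig" "length xs = sig ! f"
    then show "(Var 0, op (term_alg sig m') f (map (\<lambda>_. Var 0) xs)) \<in> \<theta>'"
      using var[OF m(2)] by (intro all[OF \<theta>(2)]) (auto intro!: terms.intros(2))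
  qed (use all[OF \<theta>(1)] all[OF \<theta>(2)] var m in auto)
  then show ?thesis
    using isomorphic_iff_represents[OF lawful_congruence[OF \<theta>(1)] lawful_congruence[OF \<theta>(2)]] by blast
qed

end

locale acc_variety = fg_variety sig L for sig L +
  fixes c :: "nat \<Rightarrow> trm \<times> trm \<Rightarrow> nat"
  assumes coding: "pair_coding sig c" and acc: "ACC_fg sig L c"
begin

definition rels :: "nat \<Rightarrow> nat \<Rightarrow> trm rel" where
  "rels k e = {p \<in> pairs sig k. c k p \<in> W e}"

lemma rels_pairs: "rels k e \<subseteq> pairs sig k"
  by (auto simp: rels_def)

lemma V_alg_quot: "V_alg sig L c k e = quot k (pcong k (rels k e))"
  by (simp add: V_alg_def presented_quot rels_def)

lemma V_alg_sym: "isomorphic sig (V_alg sig L c k e) B \<Longrightarrow> isomorphic sig B (V_alg sig L c k e)"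
  unfolding V_alg_quot by (rule quot_sym[OF lawful_pcong[OF rels_pairs]])

lemma inj_coding: "k \<ge> 1 \<Longrightarrow> inj_on (c k) (pairs sig k)"
  using coding unfolding pair_coding_def by (metis bij_betw_imp_inj_on)

lemma rels_image:
  assumes "k \<ge> 1" "S \<subseteq> pairs sig k" "W e = c k ` S"
  shows "rels k e = S"
  unfolding rels_def assms(3) using inj_coding[OF assms(1)] assms(2) by (auto dest: inj_onD)

text \<open>The free algebra is \<open>V_alg\<close> at an index of the empty set, so the hypothesis
  on indexed algebras covers it.\<close>

lemma ACC_free:
  assumes "k \<ge> 1"
  shows "ACC sig (quot k (pcong k {}))"
proof -
  obtain e where "W e = {}" using W_finite by blast
  then have "rels k e = {}" by (simp add: rels_def)
  then show ?thesis using acc assms unfolding ACC_fg_def V_alg_quot by metis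
qed

lemma finite_relations:
  assumes "k \<ge> 1" "R \<subseteq> pairs sig k"
  obtains S where "finite S" "S \<subseteq> R" "pcong k S = pcong k R"
proof -
  have "\<exists>S. finite S \<and> S \<subseteq> R \<and> pcong k S = pcong k R"
    unfolding pcong_def
  proof (rule ACC_finitely_generated[OF closed_term_algebra])
    show "ACC sig (quotient_algebra (term_alg sig k)
        (generated_congruence sig (term_alg sig k) (law_instances sig L {..<k})))"
      using ACC_free[OF assms(1)] unfolding pcong_def by simp
  qed (use law_instances_terms[OF variety] assms(2) in \<open>simp_all add: pairs_def\<close>)
  then show ?thesis using that by blast
qed

lemma finite_relations_lawful:
  assumes "k \<ge> 1" "lawful k \<theta>"
  obtains S where "finite S" "S \<subseteq> \<theta>" "pcong k S = \<theta>"
  using finite_relations[OF assms(1) lawful_pairs[OF assms(2)]] pcong_lawful[OF assms(2)] by metis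

text \<open>The chain condition makes every \<open>k\<close>-generated algebra finitely presented,
  so even a congruence obtained without any effectiveness has an index.\<close>

lemma lawful_index:
  assumes "k \<ge> 1" "lawful k \<theta>"
  shows "\<exists>e. V_alg sig L c k e = quot k \<theta>"
proof -
  obtain S where S: "finite S" "S \<subseteq> \<theta>" "pcong k S = \<theta>" by (rule finite_relations_lawful[OF assms]) blast
  obtain e where "W e = c k ` S" using W_finite[of "c k ` S"] S(1) by auto
  moreover have "S \<subseteq> pairs sig k" using S(2) lawful_pairs[OF assms(2)] by simp
  ultimately have "rels k e = S" using assms(1) by (intro rels_image)
  then show ?thesis unfolding V_alg_quot using S(3) by blast
qed

end

section \<open>Least elements\<close>

lemma ordinal_coding_bij: "ordinal_coding \<alpha> h \<Longrightarrow> bij_betw h \<alpha> UNIV"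
  by (simp add: ordinal_coding_def)

lemma inv_coding_inject:
  "ordinal_coding \<alpha> h \<Longrightarrow> inv_into \<alpha> h a = inv_into \<alpha> h b \<longleftrightarrow> a = b"
  using bij_betw_inv_into[OF ordinal_coding_bij, of \<alpha> h] by (auto simp: bij_betw_def inj_on_def)

lemma inv_coding_mem: "ordinal_coding \<alpha> h \<Longrightarrow> inv_into \<alpha> h a \<in> \<alpha>"
  using bij_betw_inv_into[OF ordinal_coding_bij, of \<alpha> h] by (auto simp: bij_betw_def)

lemma cnf_less_asym: "(\<beta>, \<gamma>) \<in> cnf_less \<Longrightarrow> (\<gamma>, \<beta>) \<notin> cnf_less"
  by (rule wf_not_sym[OF wf_cnf_less])

lemma cnf_less_linear: "(\<beta>, \<gamma>) \<in> cnf_less \<or> \<beta> = \<gamma> \<or> (\<gamma>, \<beta>) \<in> cnf_less"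
  using total_cnf_less unfolding total_on_def by blast

lemma ex_is_least:
  assumes "S \<noteq> {}"
  shows "\<exists>a. is_least \<alpha> h S a"
proof -
  from assms obtain x where "x \<in> S" by blast
  then obtain a where a: "a \<in> S" "\<And>b. (b, a) \<in> inv_image cnf_less (inv_into \<alpha> h) \<Longrightarrow> b \<notin> S"
    by (rule wfE_min[OF wf_inv_image[OF wf_cnf_less, of "inv_into \<alpha> h"]]) blast
  have "ord_le \<alpha> h a b" if "b \<in> S" for b
    using a(2)[of b] that cnf_less_linear[of "inv_into \<alpha> h a" "inv_into \<alpha> h b"]
    by (auto simp: ord_le_def)
  then show ?thesis using a(1) unfolding is_least_def by blast
qed

lemma ord_le_antisym:
  assumes "ordinal_coding \<alpha> h" "ord_le \<alpha> h a b" "ord_le \<alpha> h b a"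
  shows "a = b"
  using assms(2,3) cnf_less_asym[of "inv_into \<alpha> h a" "inv_into \<alpha> h b"]
    inv_coding_inject[OF assms(1), of a b] unfolding ord_le_def by auto

lemma is_least_unique:
  "ordinal_coding \<alpha> h \<Longrightarrow> is_least \<alpha> h S a \<Longrightarrow> is_least \<alpha> h S b \<Longrightarrow> a = b"
  using ord_le_antisym[of \<alpha> h a b] unfolding is_least_def by blast

lemma is_least_singleton: "is_least \<alpha> h {a} b \<longleftrightarrow> b = a"
  by (auto simp: is_least_def ord_le_def)

lemma is_least_pair: "ord_le \<alpha> h a b \<Longrightarrow> is_least \<alpha> h {a, b} a"
  by (auto simp: is_least_def ord_le_def)

text \<open>For nonempty sets this is the existence of a least element, that is, well-foundedness of
  the order on the ordinals.\<close>

lemma E_min_same: "W e = W i \<Longrightarrow> E_min h \<alpha> e i"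
  unfolding E_min_def using ex_is_least[of "W e"] by auto

section \<open>Switching arguments\<close>

context acc_variety
begin

abbreviation fg_alg :: "nat \<Rightarrow> trm set algebra" where
  "fg_alg a \<equiv> V_alg sig L c (\<pi>\<^sub>1 a) (\<pi>\<^sub>2 a)"

lemma iso_fg_iff: "iso_fg sig L c a b \<longleftrightarrow> \<pi>\<^sub>1 a \<ge> 1 \<and> \<pi>\<^sub>1 b \<ge> 1 \<and> isomorphic sig (fg_alg a) (fg_alg b)"
  unfolding iso_fg_def by (metis cpair_surj fst_conv prod_encode_inverse snd_conv)

text \<open>By the recursion theorem, some set \<open>W e\<close> is \<open>P\<close> until a finite part of the presentation
  \<open>f e\<close> is seen to
  define the algebra \<open>quot n \<eta>\<close>, and \<open>P'\<close> afterwards. So the algebra presented by \<open>f e\<close> is a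
  quotient of \<open>quot n \<eta>\<close>.\<close>

lemma quotient_step:
  assumes dec: "fp_iso_decidable sig L" and f: "computable f"
    and P: "finite P'" "P \<subseteq> P'" and n: "n \<ge> 1" and \<eta>: "lawful n \<eta>"
    and pos: "\<And>e. \<pi>\<^sub>1 (f e) \<ge> 1"
    and iso: "\<And>e. W e = P \<Longrightarrow> isomorphic sig (quot n \<eta>) (fg_alg (f e))"
  shows "\<exists>e \<eta>'. W e = P' \<and> lawful n \<eta>' \<and> \<eta> \<subseteq> \<eta>' \<and> isomorphic sig (quot n \<eta>') (fg_alg (f e))"
proof -
  obtain R where R: "finite R" "R \<subseteq> \<eta>" "pcong n R = \<eta>"
    by (rule finite_relations_lawful[OF n \<eta>]) blast
  obtain rs where rs: "set rs = R" using finite_list[OF R(1)] by blast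
  define r where "r = list_encode (map pair_num rs)"
  from dec obtain d where d: "computable d" and d_eq: "\<And>k j rs ss. k \<ge> 1 \<Longrightarrow> j \<ge> 1 \<Longrightarrow>
      set rs \<subseteq> pairs sig k \<Longrightarrow> set ss \<subseteq> pairs sig j \<Longrightarrow>
      d \<langle>\<langle>k, j\<rangle>, \<langle>list_encode (map pair_num rs), list_encode (map pair_num ss)\<rangle>\<rangle> =
      (if isomorphic sig (presented sig L k (set rs)) (presented sig L j (set ss)) then 1 else 0)"
    unfolding fp_iso_decidable_def by blast
  from coding obtain C where C: "computable C"
    and C_eq: "\<And>k p. k \<ge> 1 \<Longrightarrow> p \<in> pairs sig k \<Longrightarrow> C \<langle>k, pair_num p\<rangle> = c k p"
    unfolding pair_coding_def by blast
  \<comment> \<open>\<open>S e w\<close> says that the coded list \<open>w\<close> consists of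
    relations enumerated for \<open>f e\<close> and that these alone present
    \<open>quot n \<eta>\<close>. It is phrased on codes so that it is visibly
    semidecidable.\<close>
  define S where "S e w \<longleftrightarrow> (\<forall>m<w. m \<in> set (list_decode w) \<longrightarrow>
      m \<in> pair_num ` pairs sig (\<pi>\<^sub>1 (f e)) \<and> C \<langle>\<pi>\<^sub>1 (f e), m\<rangle> \<in> W (\<pi>\<^sub>2 (f e))) \<and>
    d \<langle>\<langle>\<pi>\<^sub>1 (f e), n\<rangle>, \<langle>w, r\<rangle>\<rangle> = 1" for e w
  have S_iff: "S e w \<longleftrightarrow> (\<exists>ws. w = list_encode (map pair_num ws) \<and> set ws \<subseteq> rels (\<pi>\<^sub>1 (f e)) (\<pi>\<^sub>2 (f e)) \<and>
      isomorphic sig (quot (\<pi>\<^sub>1 (f e)) (pcong (\<pi>\<^sub>1 (f e)) (set ws))) (quot n \<eta>))" (is "_ \<longleftrightarrow> ?r") for e w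
  proof -
    have d_ws: "d \<langle>\<langle>\<pi>\<^sub>1 (f e), n\<rangle>, \<langle>list_encode (map pair_num ws), r\<rangle>\<rangle> = 1 \<longleftrightarrow>
        isomorphic sig (quot (\<pi>\<^sub>1 (f e)) (pcong (\<pi>\<^sub>1 (f e)) (set ws))) (quot n \<eta>)"
      if "set ws \<subseteq> pairs sig (\<pi>\<^sub>1 (f e))" for ws
      using d_eq[OF pos n that, of rs] rs R lawful_pairs[OF \<eta>] by (simp add: r_def presented_quot)
    have mem: "(\<forall>m<w. m \<in> set (list_decode w) \<longrightarrow> m \<in> pair_num ` pairs sig (\<pi>\<^sub>1 (f e)) \<and>
          C \<langle>\<pi>\<^sub>1 (f e), m\<rangle> \<in> W (\<pi>\<^sub>2 (f e))) \<longleftrightarrow>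
        set (list_decode w) \<subseteq> pair_num ` rels (\<pi>\<^sub>1 (f e)) (\<pi>\<^sub>2 (f e))"
    proof -
      have "m \<in> pair_num ` pairs sig (\<pi>\<^sub>1 (f e)) \<and> C \<langle>\<pi>\<^sub>1 (f e), m\<rangle> \<in> W (\<pi>\<^sub>2 (f e)) \<longleftrightarrow>
          m \<in> pair_num ` rels (\<pi>\<^sub>1 (f e)) (\<pi>\<^sub>2 (f e))" for m
      proof
        assume "m \<in> pair_num ` pairs sig (\<pi>\<^sub>1 (f e)) \<and> C \<langle>\<pi>\<^sub>1 (f e), m\<rangle> \<in> W (\<pi>\<^sub>2 (f e))"
        then obtain p where p: "m = pair_num p" "p \<in> pairs sig (\<pi>\<^sub>1 (f e))"
          "C \<langle>\<pi>\<^sub>1 (f e), m\<rangle> \<in> W (\<pi>\<^sub>2 (f e))" by blast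
        then show "m \<in> pair_num ` rels (\<pi>\<^sub>1 (f e)) (\<pi>\<^sub>2 (f e))"
          using C_eq[OF pos, of p] by (simp add: rels_def)
      next
        assume "m \<in> pair_num ` rels (\<pi>\<^sub>1 (f e)) (\<pi>\<^sub>2 (f e))"
        then obtain p where "m = pair_num p" "p \<in> rels (\<pi>\<^sub>1 (f e)) (\<pi>\<^sub>2 (f e))" by blast
        then show "m \<in> pair_num ` pairs sig (\<pi>\<^sub>1 (f e)) \<and> C \<langle>\<pi>\<^sub>1 (f e), m\<rangle> \<in> W (\<pi>\<^sub>2 (f e))"
          using C_eq[OF pos, of p] by (auto simp: rels_def)
      qed
      then show ?thesis using less_list_code by blast
    qed
    show ?thesis
    proof
      assume "S e w"
      then have "list_decode w \<in> lists (pair_num ` rels (\<pi>\<^sub>1 (f e)) (\<pi>\<^sub>2 (f e)))"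
        unfolding S_def mem by auto
      then obtain ws where ws: "list_decode w = map pair_num ws" "set ws \<subseteq> rels (\<pi>\<^sub>1 (f e)) (\<pi>\<^sub>2 (f e))"
        unfolding lists_image by auto
      then have "w = list_encode (map pair_num ws)" by (metis list_decode_inverse)
      with \<open>S e w\<close> ws(2) d_ws[of ws] rels_pairs show ?r unfolding S_def by blast
    next
      assume ?r
      then obtain ws where ws: "w = list_encode (map pair_num ws)" "set ws \<subseteq> rels (\<pi>\<^sub>1 (f e)) (\<pi>\<^sub>2 (f e))"
        "isomorphic sig (quot (\<pi>\<^sub>1 (f e)) (pcong (\<pi>\<^sub>1 (f e)) (set ws))) (quot n \<eta>)" by blast
      have "set (list_decode w) \<subseteq> pair_num ` rels (\<pi>\<^sub>1 (f e)) (\<pi>\<^sub>2 (f e))"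
        using ws(1,2) by auto
      then show "S e w"
        unfolding S_def mem using ws d_ws[of ws] rels_pairs by blast
    qed
  qed
  have "semidecidable (\<lambda>z. \<pi>\<^sub>2 z \<in> P \<or> \<pi>\<^sub>2 z \<in> P' \<and> (\<exists>w. S (\<pi>\<^sub>1 z) w))"
    unfolding S_def
    by (intro semidecidable_disj semidecidable_conj semidecidable_ex semidecidable_ball_less
        semidecidable_imp semidecidable_pairs semidecidable_W computable_comp[OF f]
        computable_comp[OF C] semidecidable_decidable[OF decidable_eq] computable_comp[OF d]
        semidecidable_decidable[OF decidable_finite] decidable_mem_list
        computable_id computable_cfst computable_csnd computable_pair computable_const
        P(1) finite_subset[OF P(2)])
  from recursion_theorem[OF this] obtain e where
    e: "W e = {x. x \<in> P \<or> x \<in> P' \<and> (\<exists>w. S e w)}" by auto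
  let ?k = "\<pi>\<^sub>1 (f e)" and ?R = "rels (\<pi>\<^sub>1 (f e)) (\<pi>\<^sub>2 (f e))"
  \<comment> \<open>If no such list existed, \<open>W e\<close> would be \<open>P\<close> and the
    whole presentation would define \<open>quot n \<eta>\<close>. By the chain condition a finite
    part of it already does, so such a list would exist.\<close>
  have "\<exists>w. S e w"
  proof (rule ccontr)
    assume no: "\<not> (\<exists>w. S e w)"
    then have "W e = P" using e by simp
    from iso[OF this] have 1: "isomorphic sig (quot ?k (pcong ?k ?R)) (quot n \<eta>)"
      unfolding V_alg_quot by (rule quot_sym[OF \<eta>])
    obtain T where T: "finite T" "T \<subseteq> ?R" "pcong ?k T = pcong ?k ?R"
      by (rule finite_relations[OF pos rels_pairs]) blast
    obtain ws where "set ws = T" using finite_list[OF T(1)] by blast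
    then have "S e (list_encode (map pair_num ws))" unfolding S_iff using T 1 by auto
    with no show False by blast
  qed
  then obtain w where "S e w" by blast
  then obtain ws where ws: "set ws \<subseteq> ?R" and
    iso_ws: "isomorphic sig (quot ?k (pcong ?k (set ws))) (quot n \<eta>)"
    unfolding S_iff by blast
  have "W e = P'" using e \<open>\<exists>w. S e w\<close> P(2) by auto
  have law: "lawful ?k (pcong ?k (set ws))" "lawful ?k (pcong ?k ?R)"
    using ws rels_pairs by (blast intro: lawful_pcong)+
  \<comment> \<open>Relations beyond \<open>ws\<close> can only identify more, and the
    correspondence theorem carries the resulting quotient over to \<open>n\<close>
    generators.\<close>
  obtain \<eta>' where \<eta>': "congruence sig (term_alg sig n) \<eta>'" "\<eta> \<subseteq> \<eta>'"
    "isomorphic sig (quot ?k (pcong ?k ?R)) (quot n \<eta>')"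
    by (rule isomorphic_transport[OF lawful_congruence[OF law(1)] lawful_congruence[OF \<eta>]
        lawful_congruence[OF law(2)] pcong_mono[OF rels_pairs ws] iso_ws]) blast
  have "lawful n \<eta>'" using \<eta>' \<eta> unfolding lawful_def by blast
  moreover have "isomorphic sig (quot n \<eta>') (fg_alg (f e))"
    using quot_sym[OF law(2) \<eta>'(3)] unfolding V_alg_quot .
  ultimately show ?thesis using \<open>W e = P'\<close> \<eta>'(2) by blast
qed

text \<open>By the recursion theorem, the relations with some index \<open>e\<close> present \<open>quot n \<theta>\<close> until
  \<open>b\<close> is enumerated into \<open>W (r e)\<close>, and
  \<open>quot n \<theta>'\<close> afterwards.\<close>

lemma least_step:
  assumes r: "computable r" "\<And>e i. iso_n sig L c n e i \<longleftrightarrow> E_min h \<alpha> (r e) (r i)"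
    and \<alpha>: "ordinal_coding \<alpha> (h \<alpha>)"
    and n: "n \<ge> 1" and \<theta>: "lawful n \<theta>" "lawful n \<theta>'" "\<theta> \<subseteq> \<theta>'"
    and j: "isomorphic sig (V_alg sig L c n j) (quot n \<theta>)"
    and j': "isomorphic sig (V_alg sig L c n j') (quot n \<theta>')"
    and not_iso: "\<not> isomorphic sig (quot n \<theta>) (quot n \<theta>')"
  shows "W (r j') \<noteq> {}"
    and "is_least \<alpha> (h \<alpha>) (W (r j)) b \<Longrightarrow> is_least \<alpha> (h \<alpha>) (W (r j')) b' \<Longrightarrow>
      (inv_into \<alpha> (h \<alpha>) b', inv_into \<alpha> (h \<alpha>) b) \<in> cnf_less"
proof -
  have "\<not> iso_n sig L c n j j'"
    unfolding iso_n_def using isomorphic_trans[OF quot_sym[OF \<theta>(1)]] not_iso j j'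
    using V_alg_sym isomorphic_trans by meson
  then have neq: "\<not> E_min h \<alpha> (r j) (r j')" using r(2) by blast
  have less: "\<exists>a. is_least \<alpha> (h \<alpha>) (W (r j')) a \<and> (inv_into \<alpha> (h \<alpha>) a, inv_into \<alpha> (h \<alpha>) b) \<in> cnf_less"
    if b: "is_least \<alpha> (h \<alpha>) (W (r j)) b" for b
  proof -
    obtain S where S: "finite S" "S \<subseteq> \<theta>" "pcong n S = \<theta>" 
      by (rule finite_relations_lawful[OF n \<theta>(1)]) blast
    obtain T where T: "finite T" "T \<subseteq> \<theta>'" "pcong n T = \<theta>'" 
      by (rule finite_relations_lawful[OF n \<theta>(2)]) blast
    have pairs: "S \<subseteq> pairs sig n" "S \<union> T \<subseteq> pairs sig n"
      using S(2) T(2) lawful_pairs[OF \<theta>(1)] lawful_pairs[OF \<theta>(2)] by auto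
    \<comment> \<open>\<open>S\<close> stays in the larger set because its relations are present
      before the switch; the inclusion of \<open>\<theta>\<close> in \<open>\<theta>'\<close> makes
      this harmless.\<close>
    have T': "pcong n (S \<union> T) = \<theta>'"
    proof
      show "pcong n (S \<union> T) \<subseteq> \<theta>'" using S(2) T(2) \<theta>(3) by (intro pcong_least \<theta>(2)) blast
      show "\<theta>' \<subseteq> pcong n (S \<union> T)" using pcong_mono[OF pairs(2), of T] T(3) by simp
    qed
    have "semidecidable (\<lambda>z. \<pi>\<^sub>2 z \<in> c n ` S \<or> \<pi>\<^sub>2 z \<in> c n ` (S \<union> T) \<and> b \<in> W (r (\<pi>\<^sub>1 z)))"
      using S(1) T(1)
      by (intro semidecidable_disj semidecidable_conj semidecidable_W computable_comp[OF r(1)]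
          semidecidable_decidable[OF decidable_finite] computable_id computable_cfst computable_csnd
          computable_const) simp_all
    from recursion_theorem[OF this] obtain e where
      e: "W e = {x. x \<in> c n ` S \<or> x \<in> c n ` (S \<union> T) \<and> b \<in> W (r e)}" by auto
    \<comment> \<open>Otherwise \<open>e\<close> would present \<open>quot n \<theta>\<close> as
      \<open>j\<close> does, and \<open>W (r e)\<close> would have least element \<open>b\<close>
      after all.\<close>
    have mem: "b \<in> W (r e)"
    proof (rule ccontr)
      assume no: "b \<notin> W (r e)"
      then have "W e = c n ` S" using e by simp
      then have "V_alg sig L c n e = quot n \<theta>" 
        unfolding V_alg_quot using rels_image[OF n pairs(1)] S(3) by simp
      then have "E_min h \<alpha> (r j) (r e)" using j r(2)[of j e] by (simp add: iso_n_def)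
      then show False using b no is_least_unique[OF \<alpha>] unfolding E_min_def is_least_def by blast
    qed
    then have "W e = c n ` (S \<union> T)" using e by auto
    then have "V_alg sig L c n e = quot n \<theta>'" 
      unfolding V_alg_quot using rels_image[OF n pairs(2)] T' by simp
    then have "E_min h \<alpha> (r j') (r e)" using j' r(2)[of j' e] by (simp add: iso_n_def)
    then obtain a where a: "is_least \<alpha> (h \<alpha>) (W (r j')) a" "is_least \<alpha> (h \<alpha>) (W (r e)) a"
      using mem unfolding E_min_def by blast
    \<comment> \<open>\<open>a\<close> is the least element of a set that contains \<open>b\<close>;
      equality would make \<open>r j\<close> and \<open>r j'\<close> equivalent.\<close>
    then have "ord_le \<alpha> (h \<alpha>) a b" using mem unfolding is_least_def by blast
    moreover have "a \<noteq> b" using a(1) b neq unfolding E_min_def by blast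
    ultimately show ?thesis using a(1) inv_coding_inject[OF \<alpha>] unfolding ord_le_def by blast
  qed
  \<comment> \<open>Of two inequivalent sets at least one is nonempty. If it is the first, the
    switch yields a least element of the second.\<close>
  show "W (r j') \<noteq> {}"
  proof
    assume empty: "W (r j') = {}"
    then have "W (r j) \<noteq> {}" using neq unfolding E_min_def by blast
    then obtain b where "is_least \<alpha> (h \<alpha>) (W (r j)) b" using ex_is_least by blast
    from less[OF this] show False using empty unfolding is_least_def by blast
  qed
  show "(inv_into \<alpha> (h \<alpha>) b', inv_into \<alpha> (h \<alpha>) b) \<in> cnf_less"
    if "is_least \<alpha> (h \<alpha>) (W (r j)) b" "is_least \<alpha> (h \<alpha>) (W (r j')) b'"
    using less[OF that(1)] is_least_unique[OF \<alpha> that(2)] by blast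
qed

end

section \<open>Combining both descents at the supremum\<close>

theorem theorem4p14:
  fixes sig :: signature
    and L :: "(trm \<times> trm) set"
    and c :: "nat \<Rightarrow> trm \<times> trm \<Rightarrow> nat"
    and h :: "nat list set \<Rightarrow> nat list \<Rightarrow> nat"
    and \<alpha> :: "nat \<Rightarrow> nat list set"
  assumes "pair_coding sig c"
    and "\<And>\<beta>. ordinal \<beta> \<Longrightarrow> infinite \<beta> \<Longrightarrow> ordinal_coding \<beta> (h \<beta>)"
    and "variety sig L"
    and "ACC_fg sig L c"
    and "fp_iso_decidable sig L"
    and "\<And>n. n \<ge> 1 \<Longrightarrow> ordinal (\<alpha> n) \<and> infinite (\<alpha> n)"
    and "\<And>n. n \<ge> 1 \<Longrightarrow> iso_n sig L c n \<le>\<^sub>c E_min h (\<alpha> n)"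
  shows "\<not> E_min h (\<Union>n\<in>{1..}. \<alpha> n) \<le>\<^sub>c iso_fg sig L c"
proof
  interpret acc_variety sig L c
    using assms(1,3,4) by unfold_locales
  define \<kappa> where "\<kappa> = (\<Union>n\<in>{1..}. \<alpha> n)"
  assume "E_min h (\<Union>n\<in>{1..}. \<alpha> n) \<le>\<^sub>c iso_fg sig L c"
  then obtain f where f: "computable f" and
    f_iff: "\<And>x y. E_min h \<kappa> x y \<longleftrightarrow> iso_fg sig L c (f x) (f y)"
    unfolding reducible_def \<kappa>_def by blast
  have sub: "\<alpha> n \<subseteq> \<kappa>" if "n \<ge> 1" for n using that unfolding \<kappa>_def by auto
  have "ordinal \<kappa>"
    unfolding ordinal_def
  proof (intro conjI ballI impI)
    show "\<kappa> \<subseteq> cnf" using assms(6) unfolding \<kappa>_def ordinal_def by auto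
    fix \<beta> \<gamma> assume "\<beta> \<in> \<kappa>" and \<gamma>: "\<gamma> \<in> cnf" "(\<gamma>, \<beta>) \<in> cnf_less"
    then obtain n where n: "n \<ge> 1" "\<beta> \<in> \<alpha> n" unfolding \<kappa>_def by auto
    then have "\<gamma> \<in> \<alpha> n" using assms(6)[OF n(1)] \<gamma> unfolding ordinal_def by blast
    then show "\<gamma> \<in> \<kappa>" using sub[OF n(1)] by blast
  qed
  moreover have "infinite \<kappa>" using assms(6)[of 1] sub[of 1] finite_subset by auto
  ultimately have coding_\<kappa>: "ordinal_coding \<kappa> (h \<kappa>)" by (rule assms(2))
  have inv_h: "inv_into \<kappa> (h \<kappa>) (h \<kappa> \<delta>) = \<delta>" if "\<delta> \<in> \<kappa>" for \<delta>
    using that bij_betw_inv_into_left[OF ordinal_coding_bij[OF coding_\<kappa>]] by simp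

  \<comment> \<open>\<open>E_min\<close> is reflexive, so \<open>f\<close> only takes values that
    are related to themselves, which are the codes with a positive first component.\<close>
  have pos: "\<pi>\<^sub>1 (f e) \<ge> 1" for e
    using f_iff[of e e] E_min_same[of e e h \<kappa>] by (simp add: iso_fg_iff)
  have iso_iff: "isomorphic sig (fg_alg (f x)) (fg_alg (f y)) \<longleftrightarrow> E_min h \<kappa> x y" for x y
    using f_iff[of x y] pos by (simp add: iso_fg_iff)

  obtain e\<^sub>0 where e\<^sub>0: "W e\<^sub>0 = {}" using W_finite[of "{}"] by auto
  define k where "k = \<pi>\<^sub>1 (f e\<^sub>0)"
  define n where "n = Suc k"
  have k: "k \<ge> 1" and n: "n \<ge> 1" using pos by (simp_all add: k_def n_def)
  define \<Phi> where "\<Phi> = pcong n {}"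
  have \<Phi>: "lawful n \<Phi>" unfolding \<Phi>_def by (rule lawful_pcong) simp
  obtain \<eta> where \<eta>: "lawful n \<eta>" "isomorphic sig (quot n \<eta>) (fg_alg (f e\<^sub>0))" "(Var 0, Var k) \<in> \<eta>"
    unfolding n_def V_alg_quot k_def[symmetric]
    by (rule extra_generator[OF lawful_pcong[OF rels_pairs] k]) blast
  have "\<Phi> \<subseteq> \<eta>" unfolding \<Phi>_def by (rule pcong_least[OF \<eta>(1)]) simp
  have free: "\<not> isomorphic sig (quot n \<Phi>) (quot n \<eta>)"
  proof
    assume "isomorphic sig (quot n \<Phi>) (quot n \<eta>)"
    then have "isomorphic sig (quot n \<eta>) (quot n \<Phi>)" by (rule quot_sym[OF \<Phi>])
    moreover have "ACC sig (quot n \<Phi>)" unfolding \<Phi>_def by (rule ACC_free[OF n])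
    ultimately have "\<eta> = \<Phi>"
      using ACC_hopfian lawful_congruence[OF \<Phi>] lawful_congruence[OF \<eta>(1)] \<open>\<Phi> \<subseteq> \<eta>\<close> by blast
    then have eq: "(Var 0, Var k) \<in> pcong n {}" using \<eta>(3) by (simp add: \<Phi>_def)
    \<comment> \<open>The variety is now trivial, so \<open>f\<close> sends indices of the
      inequivalent sets \<open>{}\<close> and \<open>{0}\<close> to isomorphic algebras.\<close>
    obtain e\<^sub>1 where e\<^sub>1: "W e\<^sub>1 = {0}" using W_finite[of "{0}"] by auto
    have "isomorphic sig (fg_alg (f e\<^sub>0)) (fg_alg (f e\<^sub>1))"
      unfolding V_alg_quot using k
      by (intro trivial_variety[OF eq] lawful_pcong[OF rels_pairs] pos) simp
    then show False using e\<^sub>0 e\<^sub>1 by (simp add: iso_iff E_min_def is_least_def)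
  qed

  have coding_n: "ordinal_coding (\<alpha> n) (h (\<alpha> n))" using assms(2,6) n by blast
  from assms(7)[OF n] obtain r where r: "computable r" and
    r_iff: "\<And>e i. iso_n sig L c n e i \<longleftrightarrow> E_min h (\<alpha> n) (r e) (r i)"
    unfolding reducible_def by blast
  let ?inv = "inv_into (\<alpha> n) (h (\<alpha> n))"
  obtain j\<^sub>\<Phi> where j\<^sub>\<Phi>: "V_alg sig L c n j\<^sub>\<Phi> = quot n \<Phi>" using lawful_index[OF n \<Phi>] by blast
  obtain j\<^sub>0 where j\<^sub>0: "V_alg sig L c n j\<^sub>0 = quot n \<eta>" using lawful_index[OF n \<eta>(1)] by blast
  note step = least_step[OF r r_iff coding_n n]
  have "W (r j\<^sub>0) \<noteq> {}"
    using step(1)[OF \<Phi> \<eta>(1) \<open>\<Phi> \<subseteq> \<eta>\<close> _ _ free] j\<^sub>\<Phi> j\<^sub>0 isomorphic_refl by metis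
  then obtain b\<^sub>0 where b\<^sub>0: "is_least (\<alpha> n) (h (\<alpha> n)) (W (r j\<^sub>0)) b\<^sub>0" using ex_is_least by blast

  have "\<forall>\<delta>\<in>\<kappa>. \<exists>e \<theta> j b. W e = {h \<kappa> \<delta>} \<and> lawful n \<theta> \<and> \<eta> \<subseteq> \<theta> \<and>
      isomorphic sig (quot n \<theta>) (fg_alg (f e)) \<and> V_alg sig L c n j = quot n \<theta> \<and>
      is_least (\<alpha> n) (h (\<alpha> n)) (W (r j)) b \<and> (?inv b, ?inv b\<^sub>0) \<in> cnf_less"
  proof
    fix \<delta> assume "\<delta> \<in> \<kappa>"
    have iso: "isomorphic sig (quot n \<eta>) (fg_alg (f e))" if "W e = {}" for e
      using isomorphic_trans[OF \<eta>(2)] iso_iff[of e\<^sub>0 e] E_min_same[of e\<^sub>0 e] that e\<^sub>0 by simp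
    obtain e \<theta> where e: "W e = {h \<kappa> \<delta>}" and \<theta>: "lawful n \<theta>" "\<eta> \<subseteq> \<theta>"
      "isomorphic sig (quot n \<theta>) (fg_alg (f e))"
      \<comment> \<open>The waiting starts from the empty set, which every singleton enlarges. The
        same index must serve for the set and for the algebra, so \<open>e\<close> is the one
        supplied by the recursion theorem.\<close>
      using quotient_step[OF assms(5) f _ _ n \<eta>(1) pos iso, of "{h \<kappa> \<delta>}"] by blast
    obtain j where j: "V_alg sig L c n j = quot n \<theta>" using lawful_index[OF n \<theta>(1)] by blast
    have "\<not> isomorphic sig (quot n \<eta>) (quot n \<theta>)"
    proof
      assume "isomorphic sig (quot n \<eta>) (quot n \<theta>)"
      then have "isomorphic sig (fg_alg (f e\<^sub>0)) (fg_alg (f e))"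
        using isomorphic_trans quot_sym[OF \<eta>(1) \<eta>(2)] \<theta>(3) by metis
      then show False using e e\<^sub>0 by (simp add: iso_iff E_min_def is_least_def)
    qed
    note step' = step[OF \<eta>(1) \<theta>(1,2) _ _ this, of j\<^sub>0 j, unfolded j j\<^sub>0, OF isomorphic_refl isomorphic_refl]
    obtain b where b: "is_least (\<alpha> n) (h (\<alpha> n)) (W (r j)) b" using ex_is_least[OF step'(1)] by blast
    from step'(2)[OF b\<^sub>0 b] have "(?inv b, ?inv b\<^sub>0) \<in> cnf_less" .
    with e \<theta> j b show "\<exists>e \<theta> j b. W e = {h \<kappa> \<delta>} \<and> lawful n \<theta> \<and> \<eta> \<subseteq> \<theta> \<and>
        isomorphic sig (quot n \<theta>) (fg_alg (f e)) \<and> V_alg sig L c n j = quot n \<theta> \<and>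
        is_least (\<alpha> n) (h (\<alpha> n)) (W (r j)) b \<and> (?inv b, ?inv b\<^sub>0) \<in> cnf_less" by blast
  qed
  then obtain e \<theta> j b where "\<forall>\<delta>\<in>\<kappa>. W (e \<delta>) = {h \<kappa> \<delta>} \<and> lawful n (\<theta> \<delta>) \<and> \<eta> \<subseteq> \<theta> \<delta> \<and>
      isomorphic sig (quot n (\<theta> \<delta>)) (fg_alg (f (e \<delta>))) \<and> V_alg sig L c n (j \<delta>) = quot n (\<theta> \<delta>) \<and>
      is_least (\<alpha> n) (h (\<alpha> n)) (W (r (j \<delta>))) (b \<delta>) \<and> (?inv (b \<delta>), ?inv b\<^sub>0) \<in> cnf_less"
    unfolding bchoice_iff by (elim exE)
  then have
    e: "\<And>\<delta>. \<delta> \<in> \<kappa> \<Longrightarrow> W (e \<delta>) = {h \<kappa> \<delta>}" and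
    \<theta>: "\<And>\<delta>. \<delta> \<in> \<kappa> \<Longrightarrow> lawful n (\<theta> \<delta>)" and
    iso: "\<And>\<delta>. \<delta> \<in> \<kappa> \<Longrightarrow> isomorphic sig (quot n (\<theta> \<delta>)) (fg_alg (f (e \<delta>)))" and
    j: "\<And>\<delta>. \<delta> \<in> \<kappa> \<Longrightarrow> V_alg sig L c n (j \<delta>) = quot n (\<theta> \<delta>)" and
    b: "\<And>\<delta>. \<delta> \<in> \<kappa> \<Longrightarrow> is_least (\<alpha> n) (h (\<alpha> n)) (W (r (j \<delta>))) (b \<delta>)" and
    b_less: "\<And>\<delta>. \<delta> \<in> \<kappa> \<Longrightarrow> (?inv (b \<delta>), ?inv b\<^sub>0) \<in> cnf_less"
    by simp_all
  have E_min_iff: "E_min h \<kappa> x y \<longleftrightarrow> \<delta> = \<epsilon>"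
    if "is_least \<kappa> (h \<kappa>) (W x) (h \<kappa> \<delta>)" "is_least \<kappa> (h \<kappa>) (W y) (h \<kappa> \<epsilon>)" "\<delta> \<in> \<kappa>" "\<epsilon> \<in> \<kappa>" for x y \<delta> \<epsilon>
  proof
    assume "E_min h \<kappa> x y"
    moreover have "W x \<noteq> {}" using that(1) unfolding is_least_def by blast
    ultimately obtain a where "is_least \<kappa> (h \<kappa>) (W x) a" "is_least \<kappa> (h \<kappa>) (W y) a"
      unfolding E_min_def by blast
    then have "h \<kappa> \<delta> = h \<kappa> \<epsilon>" using is_least_unique[OF coding_\<kappa>] that(1,2) by metis
    then show "\<delta> = \<epsilon>" using inv_h that(3,4) by metis
  qed (use that in \<open>auto simp: E_min_def\<close>)

  have mono: "(?inv (b \<gamma>), ?inv (b \<delta>)) \<in> cnf_less"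
    if \<gamma>\<delta>: "\<gamma> \<in> \<kappa>" "\<delta> \<in> \<kappa>" and less: "(\<gamma>, \<delta>) \<in> cnf_less" for \<gamma> \<delta>
  proof -
    have iso': "isomorphic sig (quot n (\<theta> \<delta>)) (fg_alg (f x))" if "W x = {h \<kappa> \<delta>}" for x
      using isomorphic_trans[OF iso[OF \<gamma>\<delta>(2)]] iso_iff[of "e \<delta>" x] E_min_same[of "e \<delta>" x] that e[OF \<gamma>\<delta>(2)]
      by simp
    \<comment> \<open>Enlarging \<open>{h \<kappa> \<delta>}\<close> by the code of the smaller
      \<open>\<gamma>\<close> gives a set equivalent to the singleton of \<open>\<gamma>\<close>. So
      \<open>\<theta>'\<close> is a copy of \<open>\<theta> \<gamma>\<close> up to isomorphism that
      lies above \<open>\<theta> \<delta>\<close>, which \<open>\<theta> \<gamma>\<close> itself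
      need not do.\<close>
    obtain e' \<theta>' where e': "W e' = {h \<kappa> \<gamma>, h \<kappa> \<delta>}" and \<theta>': "lawful n \<theta>'" "\<theta> \<delta> \<subseteq> \<theta>'"
      "isomorphic sig (quot n \<theta>') (fg_alg (f e'))"
      using quotient_step[OF assms(5) f _ _ n \<theta>[OF \<gamma>\<delta>(2)] pos iso', of "{h \<kappa> \<gamma>, h \<kappa> \<delta>}"] by blast
    have least: "is_least \<kappa> (h \<kappa>) (W e') (h \<kappa> \<gamma>)"
      unfolding e' using less inv_h \<gamma>\<delta> by (intro is_least_pair) (simp add: ord_le_def)
    have least_e: "is_least \<kappa> (h \<kappa>) (W (e \<epsilon>)) (h \<kappa> \<epsilon>)" if "\<epsilon> \<in> \<kappa>" for \<epsilon>
      using e[OF that] by (simp add: is_least_singleton)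
    have "isomorphic sig (fg_alg (f e')) (fg_alg (f (e \<gamma>)))"
      unfolding iso_iff using E_min_iff[OF least least_e] \<gamma>\<delta> by blast
    then have "isomorphic sig (quot n (\<theta> \<gamma>)) (quot n \<theta>')"
      using isomorphic_trans[OF \<theta>'(3)] isomorphic_trans quot_sym[OF \<theta>[OF \<gamma>\<delta>(1)] iso[OF \<gamma>\<delta>(1)]]
        quot_sym[OF \<theta>'(1)] by metis
    moreover have "\<not> isomorphic sig (quot n (\<theta> \<delta>)) (quot n \<theta>')"
    proof
      assume "isomorphic sig (quot n (\<theta> \<delta>)) (quot n \<theta>')"
      then have "isomorphic sig (fg_alg (f (e \<delta>))) (fg_alg (f e'))"
        using isomorphic_trans quot_sym[OF \<theta>[OF \<gamma>\<delta>(2)] iso[OF \<gamma>\<delta>(2)]] \<theta>'(3) by metis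
      then have "\<delta> = \<gamma>" unfolding iso_iff using E_min_iff[OF least_e least] \<gamma>\<delta> by blast
      then show False using less cnf_less_asym by blast
    qed
    ultimately show ?thesis
      using step(2)[OF \<theta>[OF \<gamma>\<delta>(2)] \<theta>'(1,2), of "j \<delta>" "j \<gamma>" "b \<delta>" "b \<gamma>"] j b \<gamma>\<delta> isomorphic_refl
      by metis
  qed

  have inv_mem: "?inv a \<in> \<kappa>" for a using inv_coding_mem[OF coding_n] sub[OF n] by blast
  have "(?inv (b (?inv b\<^sub>0)), ?inv b\<^sub>0) \<in> cnf_less" using b_less[OF inv_mem] .
  \<comment> \<open>A minimal counterexample is impossible: if \<open>\<delta>\<close> is mapped
    below itself, then by monotonicity so is its image, which is smaller.\<close>
  moreover have "(?inv (b \<delta>), \<delta>) \<in> cnf_less \<longrightarrow> \<delta> \<notin> \<kappa>" for \<delta>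
  proof (induction \<delta> rule: wf_induct[OF wf_cnf_less])
    case (1 \<delta>)
    then show ?case using mono inv_mem by blast
  qed
  ultimately show False using inv_mem by blast
qed

end
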